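(* Let $(\mathcal{P},\overline{E})$ be a radical curve parametrization with $\overline{E}=(E_1,\ldots,E_m)$ and $$\mathcal{P}(t,\overline{\Delta})=\left(\frac{p_1(t,\overline{\Delta})}{q_1(t,\overline{\Delta})},\ldots,\frac{p_n(t,\overline{\Delta})}{q_n(t,\overline{\Delta})}\right),\qquad p_i,q_i\in\mathbb{C}[t,\overline{\Delta}],$$ such that $N(p_i)=p_i$ and $N(q_i)=q_i$ for all $i=1,\ldots,n$. Suppose that: 1. there exists $i\in\{1,\ldots,n\}$ such that $p_i$ is not suspicious and $\deg p_i>\deg q_i$; 2. for all $i\in\{1,\ldots,n\}$, the ideal $I_i(\mathcal{P}):=\langle E_1,\ldots,E_m,p_i,q_i\rangle$ is the whole ring $\mathbb{C}[t,\overline{\Delta}]$. Then the parametrization is surjective.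
   Context: **Radical curve parametrization.** Let $\mathbb{F}_0=\mathbb{C}(t)\subseteq\mathbb{F}_1\subseteq\cdots\subseteq\mathbb{F}_m$ be a radical tower: $\mathbb{F}_i=\mathbb{F}_{i-1}(\delta_i)$ with $\delta_i^{e_i}\in\mathbb{F}_{i-1}$, $e_i$ a positive integer. Write $\overline{\delta}=(\delta_1,\ldots,\delta_m)$ and $\overline{\Delta}=(\Delta_1,\ldots,\Delta_m)$ for corresponding variables. The defining polynomials of the $\delta_i$ are $E_i=\Delta_i^{e_i}-g_i(t,\Delta_1,\ldots,\Delta_{i-1})\in\mathbb{C}[t,\overline{\Delta}]$, where $g_i$ is a nonzero polynomial with $\deg_{\Delta_j}(g_i)<e_j$ for $j<i$, and $E_i(t,\overline{\delta})=0$. A radical curve parametrization is given by a tuple $\mathcal{P}(t,\overline{\Delta})=(p_1/q_1,\ldots,p_n/q_n)$ with $p_i,q_i\in\mathbb{C}[t,\overline{\Delta}]$, $q_i(t,\overline{\delta})\neq 0$, together with $\overline{E}=(E_1,\ldots,E_m)$, where the elements $x_i=p_i(t,\overline{\delta})/q_i(t,\overline{\delta})\in\mathbb{F}_m$ are not all constant (the Jacobian with respect to $t$ has rank one). **Surjective.** Let $X(\mathcal{P})\subseteq\mathbb{C}^n$ be the set of all $\overline{x}\in\mathbb{C}^n$ for which there is $(t,\overline{\Delta})\in\mathbb{C}^{m+1}$ such that $E_i(t,\overline{\Delta})=0$ for all $i=1,\ldots,m$, $\mathcal{P}(t,\overline{\Delta})$ is well defined (i.e. $q_i(t,\overline{\Delta})\ne0$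 for all $i$), and $\mathcal{P}(t,\overline{\Delta})=\overline{x}$. The parametrization is surjective when $X(\mathcal{P})$ is Zariski closed in $\mathbb{C}^n$. **Weighted degree.** $\deg$ on $\mathbb{C}[t,\overline{\Delta}]$ is the weighted degree with rational weights given by $\deg(t)=1$ and, recursively, $\deg(\Delta_i)=\deg(g_i)/e_i$ (and $\deg 0=-\infty$). **Normal form.** $N(f)$ is the normal form of $f\in\mathbb{C}[t,\overline{\Delta}]$ with respect to $\{E_1,\ldots,E_m\}$ (a Gröbner basis for the lexicographic order $\Delta_m>\cdots>\Delta_1>t$), i.e. the polynomial obtained by repeatedly substituting every instance of $\Delta_i^{e_i}$ by $g_i$. Thus $N(f)=f$ means $\deg_{\Delta_i}(f)<e_i$ for all $i$. **Suspicious.** Recursively, $f\in\mathbb{C}[t,\overline{\Delta}]$ is suspicious when either (1) $f$ has at least two terms (monomials with nonzero coefficient) of highest weighted degree; or (2) for some $i$, $\Delta_i$ appears in the (only) leading term of $f$ and $g_i(t,\Delta_1,\ldots,\Delta_{i-1})$ is suspicious. *)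

theory Defs
  imports
    "HOL-Analysis.Analysis"
    "HOL-Algebra.Algebraic_Closure_Type"
    "HOL-Algebra.Generated_Fields"
    "HOL-Library.Poly_Mapping"
    "HOL-Library.Extended"
begin

section \<open>Multivariate polynomials over the complex numbers\<close>

type_synonym 'v mpoly = "('v \<Rightarrow>\<^sub>0 nat) \<Rightarrow>\<^sub>0 complex"

abbreviation mcoeff :: "'v mpoly \<Rightarrow> ('v \<Rightarrow>\<^sub>0 nat) \<Rightarrow> complex" where
  "mcoeff \<equiv> Poly_Mapping.lookup"

abbreviation expo :: "('v \<Rightarrow>\<^sub>0 nat) \<Rightarrow> 'v \<Rightarrow> nat" where
  "expo \<equiv> Poly_Mapping.lookup"

abbreviation monomials :: "'v mpoly \<Rightarrow> ('v \<Rightarrow>\<^sub>0 nat) set" where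
  "monomials \<equiv> Poly_Mapping.keys"

abbreviation mvars :: "('v \<Rightarrow>\<^sub>0 nat) \<Rightarrow> 'v set" where
  "mvars \<equiv> Poly_Mapping.keys"

definition vars :: "'v mpoly \<Rightarrow> 'v set" where
  "vars f = (\<Union>\<mu>\<in>monomials f. mvars \<mu>)"

text \<open>The scalars act on the target ring through \<open>h\<close>; \<open>h = id\<close> is evaluation at complex points.\<close>

definition eval_via :: "(complex \<Rightarrow> 'a::comm_ring_1) \<Rightarrow> 'v mpoly \<Rightarrow> ('v \<Rightarrow> 'a) \<Rightarrow> 'a" where
  "eval_via h f v = (\<Sum>\<mu>\<in>monomials f. h (mcoeff f \<mu>) * (\<Prod>k\<in>mvars \<mu>. v k ^ expo \<mu> k))"

abbreviation mpoly_eval :: "'v mpoly \<Rightarrow> ('v \<Rightarrow> complex) \<Rightarrow> complex" where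
  "mpoly_eval \<equiv> eval_via id"

definition degree_in :: "'v \<Rightarrow> 'v mpoly \<Rightarrow> nat" where
  "degree_in k f = Max (insert 0 ((\<lambda>\<mu>. expo \<mu> k) ` monomials f))"

definition zariski_closed :: "(complex ^ 'n::finite) set \<Rightarrow> bool" where
  "zariski_closed A \<longleftrightarrow> (\<exists>S :: 'n mpoly set. A = {x. \<forall>f\<in>S. mpoly_eval f (vec_nth x) = 0})"

text \<open>In polynomials over \<open>nat\<close>-indexed variables, variable \<open>0\<close> is \<open>t\<close> and variable \<open>i \<ge> 1\<close>
  is \<open>\<Delta>\<^sub>i\<close>; thus \<open>param_ring m\<close> is the ring of polynomials in \<open>t, \<Delta>\<^sub>1, \<dots>, \<Delta>\<^sub>m\<close>.\<close>

definition param_ring :: "nat \<Rightarrow> nat mpoly ring" where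
  "param_ring m = ring_of_type_algebra \<lparr>carrier := {f. vars f \<subseteq> {..m}}\<rparr>"

lemma param_ring_cring: "cring (param_ring m)"
proof -
  have add: "vars (f + h) \<subseteq> vars f \<union> vars h" for f h :: "nat mpoly"
    using Poly_Mapping.keys_add[of f h] by (auto simp: vars_def)
  have neg: "vars (- f) = vars f" for f :: "nat mpoly"
    by (simp add: vars_def)
  have mult: "vars (f * h) \<subseteq> vars f \<union> vars h" for f h :: "nat mpoly"
  proof
    fix k assume "k \<in> vars (f * h)"
    then obtain \<mu> where "\<mu> \<in> monomials (f * h)" "k \<in> mvars \<mu>" by (auto simp: vars_def)
    moreover from this(1) obtain a b where "\<mu> = a + b" "a \<in> monomials f" "b \<in> monomials h"
      using keys_mult[of f h] by blast
    ultimately show "k \<in> vars f \<union> vars h"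
      using Poly_Mapping.keys_add[of a b] by (auto simp: vars_def)
  qed
  interpret R: cring "ring_of_type_algebra :: nat mpoly ring" by rule
  have inv: "\<ominus>\<^bsub>ring_of_type_algebra\<^esub> f = - f" for f :: "nat mpoly"
    by (rule R.minus_equality) (auto simp: ring_of_type_algebra_def)
  have "subring {f. vars f \<subseteq> {..m}} (ring_of_type_algebra :: nat mpoly ring)"
  proof (rule R.subringI)
    show "{f. vars f \<subseteq> {..m}} \<subseteq> carrier ring_of_type_algebra"
      and "\<one>\<^bsub>ring_of_type_algebra\<^esub> \<in> {f. vars f \<subseteq> {..m}}"
      by (auto simp: ring_of_type_algebra_def vars_def)
  next
    fix f assume "f \<in> {f. vars f \<subseteq> {..m}}"
    then show "\<ominus>\<^bsub>ring_of_type_algebra\<^esub> f \<in> {f. vars f \<subseteq> {..m}}"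
      by (simp only: inv neg mem_Collect_eq)
  next
    fix f h assume "f \<in> {f. vars f \<subseteq> {..m}}" "h \<in> {f. vars f \<subseteq> {..m}}"
    then show "f \<otimes>\<^bsub>ring_of_type_algebra\<^esub> h \<in> {f. vars f \<subseteq> {..m}}"
      and "f \<oplus>\<^bsub>ring_of_type_algebra\<^esub> h \<in> {f. vars f \<subseteq> {..m}}"
      using add[of f h] mult[of f h] by (auto simp: ring_of_type_algebra_def)
  qed
  then have "subcring {f. vars f \<subseteq> {..m}} (ring_of_type_algebra :: nat mpoly ring)"
    by (rule R.subcringI')
  then show ?thesis unfolding param_ring_def
    by (subst (asm) R.subcring_iff) (simp_all add: ring_of_type_algebra_def)
qed


section \<open>Radical towers and their defining polynomials\<close>

text \<open>An embedding \<open>j\<close> of the rational function field in \<open>t\<close> into an ambient field makes the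
  latter an extension; the tower lives inside the ambient field.\<close>

definition is_field_embedding :: "(complex poly fract \<Rightarrow> 'f::field) \<Rightarrow> bool" where
  "is_field_embedding j \<longleftrightarrow> j \<in> ring_hom ring_of_type_algebra ring_of_type_algebra"

definition const_in :: "(complex poly fract \<Rightarrow> 'f) \<Rightarrow> complex \<Rightarrow> 'f" where
  "const_in j c = j (Fract [:c:] 1)"

definition t_in :: "(complex poly fract \<Rightarrow> 'f) \<Rightarrow> 'f" where
  "t_in j = j (Fract [:0, 1:] 1)"

primrec tower :: "(complex poly fract \<Rightarrow> 'f::field) \<Rightarrow> (nat \<Rightarrow> 'f) \<Rightarrow> nat \<Rightarrow> 'f set" where
  "tower j \<delta> 0 = range j"
| "tower j \<delta> (Suc i) = generate_field ring_of_type_algebra (insert (\<delta> (Suc i)) (tower j \<delta> i))"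

definition radical_tower ::
    "(complex poly fract \<Rightarrow> 'f::field) \<Rightarrow> nat \<Rightarrow> (nat \<Rightarrow> 'f) \<Rightarrow> (nat \<Rightarrow> nat) \<Rightarrow> bool" where
  "radical_tower j m \<delta> e \<longleftrightarrow>
     is_field_embedding j \<and> (\<forall>i\<in>{1..m}. e i > 0 \<and> \<delta> i ^ e i \<in> tower j \<delta> (i - 1))"

definition rad_poly :: "(nat \<Rightarrow> nat) \<Rightarrow> (nat \<Rightarrow> nat mpoly) \<Rightarrow> nat \<Rightarrow> nat mpoly" where
  "rad_poly e g i = Poly_Mapping.single (Poly_Mapping.single i (e i)) 1 - g i"

definition generic_value :: "(complex poly fract \<Rightarrow> 'f::field) \<Rightarrow> (nat \<Rightarrow> 'f) \<Rightarrow> nat mpoly \<Rightarrow> 'f" where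
  "generic_value j \<delta> f = eval_via (const_in j) f (\<lambda>i. if i = 0 then t_in j else \<delta> i)"

definition defining_polys ::
    "(complex poly fract \<Rightarrow> 'f::field) \<Rightarrow> nat \<Rightarrow> (nat \<Rightarrow> 'f) \<Rightarrow> (nat \<Rightarrow> nat) \<Rightarrow> (nat \<Rightarrow> nat mpoly) \<Rightarrow> bool"
  where
  "defining_polys j m \<delta> e g \<longleftrightarrow>
     (\<forall>i\<in>{1..m}. g i \<noteq> 0 \<and> vars (g i) \<subseteq> {..<i} \<and> (\<forall>k\<in>{1..<i}. degree_in k (g i) < e k) \<and>
        generic_value j \<delta> (rad_poly e g i) = 0)"

definition radical_curve_parametrization ::
    "(complex poly fract \<Rightarrow> 'f::field) \<Rightarrow> nat \<Rightarrow> (nat \<Rightarrow> 'f) \<Rightarrow> (nat \<Rightarrow> nat) \<Rightarrow> (nat \<Rightarrow> nat mpoly) \<Rightarrow>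
     ('n::finite \<Rightarrow> nat mpoly) \<Rightarrow> ('n \<Rightarrow> nat mpoly) \<Rightarrow> bool" where
  "radical_curve_parametrization j m \<delta> e g p q \<longleftrightarrow>
     radical_tower j m \<delta> e \<and> defining_polys j m \<delta> e g \<and>
     (\<forall>k. p k \<in> carrier (param_ring m) \<and> q k \<in> carrier (param_ring m) \<and>
        generic_value j \<delta> (q k) \<noteq> 0) \<and>
     (\<exists>k. generic_value j \<delta> (p k) / generic_value j \<delta> (q k) \<notin> range (const_in j))"

text \<open>A point \<open>v\<close> assigns a value to every variable, but only the coordinates \<open>0, \<dots>, m\<close> matter
  for polynomials in \<open>param_ring m\<close>.\<close>

definition param_image ::
    "nat \<Rightarrow> (nat \<Rightarrow> nat) \<Rightarrow> (nat \<Rightarrow> nat mpoly) \<Rightarrow> ('n::finite \<Rightarrow> nat mpoly) \<Rightarrow> ('n \<Rightarrow> nat mpoly) \<Rightarrow>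
     (complex ^ 'n) set" where
  "param_image m e g p q =
     {x. \<exists>v. (\<forall>i\<in>{1..m}. mpoly_eval (rad_poly e g i) v = 0) \<and>
             (\<forall>k. mpoly_eval (q k) v \<noteq> 0) \<and>
             x = (\<chi> k. mpoly_eval (p k) v / mpoly_eval (q k) v)}"

definition surjective_param ::
    "nat \<Rightarrow> (nat \<Rightarrow> nat) \<Rightarrow> (nat \<Rightarrow> nat mpoly) \<Rightarrow> ('n::finite \<Rightarrow> nat mpoly) \<Rightarrow> ('n \<Rightarrow> nat mpoly) \<Rightarrow> bool"
  where
  "surjective_param m e g p q \<longleftrightarrow> zariski_closed (param_image m e g p q)"

definition base_ideal ::
    "nat \<Rightarrow> (nat \<Rightarrow> nat) \<Rightarrow> (nat \<Rightarrow> nat mpoly) \<Rightarrow> nat mpoly \<Rightarrow> nat mpoly \<Rightarrow> nat mpoly set" where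
  "base_ideal m e g a b = genideal (param_ring m) (rad_poly e g ` {1..m} \<union> {a, b})"


section \<open>Weighted degree, normal form, suspicious polynomials\<close>

definition mono_weight :: "(nat \<Rightarrow> rat) \<Rightarrow> (nat \<Rightarrow>\<^sub>0 nat) \<Rightarrow> rat" where
  "mono_weight w \<mu> = (\<Sum>k\<in>mvars \<mu>. of_nat (expo \<mu> k) * w k)"

text \<open>\<open>Minf\<close> is the degree \<open>-\<infinity>\<close> of the zero polynomial.\<close>

definition wdeg_wrt :: "(nat \<Rightarrow> rat) \<Rightarrow> nat mpoly \<Rightarrow> rat extended" where
  "wdeg_wrt w f = Max (insert Minf ((\<lambda>\<mu>. Fin (mono_weight w \<mu>)) ` monomials f))"

text \<open>The guard \<open>k < i\<close> only serves termination, since \<open>g i\<close> involves no other variables;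
  the last case branch is never taken, since \<open>g i\<close> is nonzero.\<close>

function weight :: "(nat \<Rightarrow> nat) \<Rightarrow> (nat \<Rightarrow> nat mpoly) \<Rightarrow> nat \<Rightarrow> rat" where
  "weight e g i =
     (if i = 0 then 1
      else case wdeg_wrt (\<lambda>k. if k < i then weight e g k else 0) (g i) of
             Fin d \<Rightarrow> d / of_nat (e i)
           | _ \<Rightarrow> 0)"
  by pat_completeness auto
termination
  by (relation "Wellfounded.measure (\<lambda>(e, g, i). i)") auto

declare weight.simps [simp del]

definition wdeg :: "(nat \<Rightarrow> nat) \<Rightarrow> (nat \<Rightarrow> nat mpoly) \<Rightarrow> nat mpoly \<Rightarrow> rat extended" where
  "wdeg e g f = wdeg_wrt (weight e g) f"

lemma weight_eq:
  assumes "i \<ge> 1" "vars (g i) \<subseteq> {..<i}"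
  shows "weight e g i = (case wdeg e g (g i) of Fin d \<Rightarrow> d / of_nat (e i) | _ \<Rightarrow> 0)"
proof -
  have "mono_weight (\<lambda>k. if k < i then weight e g k else 0) \<mu> = mono_weight (weight e g) \<mu>"
    if "\<mu> \<in> monomials (g i)" for \<mu>
    unfolding mono_weight_def using assms(2) that
    by (intro sum.cong) (auto simp: vars_def)
  then have "wdeg_wrt (\<lambda>k. if k < i then weight e g k else 0) (g i) = wdeg e g (g i)"
    unfolding wdeg_def wdeg_wrt_def by (metis (no_types, lifting) image_cong)
  then show ?thesis using assms(1) by (subst weight.simps) simp
qed

definition leading_monomials ::
    "(nat \<Rightarrow> nat) \<Rightarrow> (nat \<Rightarrow> nat mpoly) \<Rightarrow> nat mpoly \<Rightarrow> (nat \<Rightarrow>\<^sub>0 nat) set" where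
  "leading_monomials e g f = {\<mu>\<in>monomials f. Fin (mono_weight (weight e g) \<mu>) = wdeg e g f}"

inductive suspicious :: "(nat \<Rightarrow> nat) \<Rightarrow> (nat \<Rightarrow> nat mpoly) \<Rightarrow> nat mpoly \<Rightarrow> bool" for e g where
  several_leading: "card (leading_monomials e g f) \<ge> 2 \<Longrightarrow> suspicious e g f"
| leading_suspicious:
    "leading_monomials e g f = {\<mu>} \<Longrightarrow> i \<ge> 1 \<Longrightarrow> i \<in> mvars \<mu> \<Longrightarrow> suspicious e g (g i) \<Longrightarrow>
     suspicious e g f"

text \<open>\<open>reduce_var e g i\<close> replaces each \<open>\<Delta>\<^sub>i\<^bsup>a\<^esup>\<close> by \<open>\<Delta>\<^sub>i\<^bsup>a mod e i\<^esup>\<close> times \<open>g i ^ (a div e i)\<close>.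
  As \<open>g i\<close> only involves smaller variables, treating \<open>\<Delta>\<^sub>m\<close> first and \<open>\<Delta>\<^sub>1\<close> last carries out
  every possible substitution.\<close>

definition reduce_var ::
    "(nat \<Rightarrow> nat) \<Rightarrow> (nat \<Rightarrow> nat mpoly) \<Rightarrow> nat \<Rightarrow> nat mpoly \<Rightarrow> nat mpoly" where
  "reduce_var e g i f =
     (\<Sum>\<mu>\<in>monomials f.
        Poly_Mapping.single (Poly_Mapping.update i (expo \<mu> i mod e i) \<mu>) (mcoeff f \<mu>) *
        g i ^ (expo \<mu> i div e i))"

primrec normal_form ::
    "(nat \<Rightarrow> nat) \<Rightarrow> (nat \<Rightarrow> nat mpoly) \<Rightarrow> nat \<Rightarrow> nat mpoly \<Rightarrow> nat mpoly" where
  "normal_form e g 0 f = f"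
| "normal_form e g (Suc m) f = normal_form e g m (reduce_var e g (Suc m) f)"

lemma degree_in_less_iff: "0 < d \<Longrightarrow> degree_in k f < d \<longleftrightarrow> (\<forall>\<mu>\<in>monomials f. expo \<mu> k < d)"
  by (simp add: degree_in_def)

lemma reduce_var_id:
  assumes "\<forall>\<mu>\<in>monomials f. expo \<mu> i < e i"
  shows "reduce_var e g i f = f"
proof -
  have "reduce_var e g i f = (\<Sum>\<mu>\<in>monomials f. Poly_Mapping.single \<mu> (mcoeff f \<mu>))"
    unfolding reduce_var_def
  proof (intro sum.cong refl)
    fix \<mu> assume "\<mu> \<in> monomials f"
    then have "expo \<mu> i < e i" using assms by blast
    moreover have "Poly_Mapping.update i (expo \<mu> i) \<mu> = \<mu>"
      by (rule poly_mapping_eqI) (simp add: lookup_update)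
    ultimately show "Poly_Mapping.single (Poly_Mapping.update i (expo \<mu> i mod e i) \<mu>) (mcoeff f \<mu>) *
        g i ^ (expo \<mu> i div e i) = Poly_Mapping.single \<mu> (mcoeff f \<mu>)" by simp
  qed
  also have "\<dots> = f"
    by (rule poly_mapping_eqI) (auto simp: lookup_sum lookup_single when_def in_keys_iff)
  finally show ?thesis .
qed

lemma normal_form_id:
  assumes "\<forall>i\<in>{1..m}. \<forall>\<mu>\<in>monomials f. expo \<mu> i < e i"
  shows "normal_form e g m f = f"
  using assms by (induction m) (auto simp: reduce_var_id)

lemma keys_power_zero:
  assumes "\<forall>\<mu>\<in>monomials f. expo \<mu> k = 0" shows "\<forall>\<mu>\<in>monomials (f ^ n). expo \<mu> k = 0"
proof (induction n)
  case 0
  show ?case by simp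
next
  case (Suc n)
  show ?case
  proof
    fix \<mu> assume "\<mu> \<in> monomials (f ^ Suc n)"
    then obtain a b where "\<mu> = a + b" "a \<in> monomials f" "b \<in> monomials (f ^ n)"
      using keys_mult[of f "f ^ n"] by auto
    then show "expo \<mu> k = 0" using assms Suc.IH by (simp add: lookup_add)
  qed
qed

definition reduced_in :: "(nat \<Rightarrow> nat) \<Rightarrow> nat \<Rightarrow> nat mpoly \<Rightarrow> bool" where
 "reduced_in e k f \<longleftrightarrow> (\<forall>\<mu>\<in>monomials f. expo \<mu> k < e k)"

lemma reduced_in_reduce_var:
  assumes "e i > 0" "vars (g i) \<subseteq> {..<i}" "k = i \<or> (k > i \<and> reduced_in e k f)"
  shows "reduced_in e k (reduce_var e g i f)"
  unfolding reduced_in_def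
proof
  fix \<nu> assume "\<nu> \<in> monomials (reduce_var e g i f)"
  then obtain \<mu> where \<mu>: "\<mu> \<in> monomials f" and
    "\<nu> \<in> monomials (Poly_Mapping.single (Poly_Mapping.update i (expo \<mu> i mod e i) \<mu>) (mcoeff f \<mu>) *
        g i ^ (expo \<mu> i div e i))"
    unfolding reduce_var_def by (blast dest: subsetD[OF keys_sum])
  then obtain a b where ab: "\<nu> = a + b" "a = Poly_Mapping.update i (expo \<mu> i mod e i) \<mu>"
     "b \<in> monomials (g i ^ (expo \<mu> i div e i))"
    by (fastforce dest!: subsetD[OF keys_mult] split: if_splits)
  have "\<forall>\<mu>\<in>monomials (g i). expo \<mu> k = 0"
    using assms(2,3) unfolding vars_def
    by (metis UN_I in_keys_iff lessThan_iff not_less_iff_gr_or_eq subsetD)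
  from keys_power_zero[OF this] ab(3) have "expo b k = 0" by (rule bspec)
  then have "expo \<nu> k = (if k = i then expo \<mu> i mod e i else expo \<mu> k)"
    by (simp add: ab(1,2) lookup_add lookup_update)
  moreover have "expo \<mu> i mod e i < e i" using assms(1) by simp
  ultimately show "expo \<nu> k < e k" using assms(3) \<mu> by (auto simp: reduced_in_def)
qed

lemma reduced_in_normal_form:
  assumes "\<And>i. i \<in> {1..m} \<Longrightarrow> e i > 0 \<and> vars (g i) \<subseteq> {..<i}"
    and "\<And>k. k \<in> {m<..M} \<Longrightarrow> reduced_in e k f" and "k \<in> {1..M}"
  shows "reduced_in e k (normal_form e g m f)"
  using assms(1,2)
proof (induction m arbitrary: f)
  case 0
  then show ?case using assms(3) by simp
next
  case (Suc m)
  have "reduced_in e i (reduce_var e g (Suc m) f)" if "i \<in> {m<..M}" for i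
  proof (rule reduced_in_reduce_var)
    show "0 < e (Suc m)" "vars (g (Suc m)) \<subseteq> {..<Suc m}"
      using Suc.prems(1)[of "Suc m"] by auto
    show "i = Suc m \<or> Suc m < i \<and> reduced_in e i f"
      using Suc.prems(2)[of i] that by auto
  qed
  with Suc.IH[of "reduce_var e g (Suc m) f"] Suc.prems(1) show ?case by simp
qed

lemma normal_form_fixed_iff:
  assumes "\<And>i. i \<in> {1..m} \<Longrightarrow> e i > 0 \<and> vars (g i) \<subseteq> {..<i}"
  shows "normal_form e g m f = f \<longleftrightarrow> (\<forall>i\<in>{1..m}. degree_in i f < e i)"
proof
  assume eq: "normal_form e g m f = f"
  show "\<forall>i\<in>{1..m}. degree_in i f < e i"
  proof
    fix i assume i: "i \<in> {1..m}"
    have "reduced_in e i (normal_form e g m f)"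
      by (rule reduced_in_normal_form[where M = m]) (use assms i in auto)
    then show "degree_in i f < e i"
      using assms[OF i] eq by (simp add: reduced_in_def degree_in_less_iff)
  qed
next
  assume deg: "\<forall>i\<in>{1..m}. degree_in i f < e i"
  have "\<forall>\<mu>\<in>monomials f. expo \<mu> i < e i" if "i \<in> {1..m}" for i
    using iffD1[OF degree_in_less_iff[OF conjunct1[OF assms[OF that]]] bspec[OF deg that]] .
  then have "\<forall>i\<in>{1..m}. \<forall>\<mu>\<in>monomials f. expo \<mu> i < e i" by (rule ballI)
  then show "normal_form e g m f = f" by (rule normal_form_id)
qed

end

theory Submission
  imports Defs "Jordan_Normal_Form.Determinant"
begin

text \<open>Let \<open>V\<close> be the affine variety of the tower; it is finite over the \<open>t\<close>-line. A polynomial that is not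
  suspicious grows on \<open>V\<close> exactly like \<open>\<bar>t\<bar>\<close> to its weighted degree, so for the index \<open>k\<close> of the first
  hypothesis \<open>q\<^sub>k / p\<^sub>k\<close> tends to \<open>0\<close> at infinity on \<open>V\<close>. Hence the norm \<open>R(x, t)\<close> of \<open>p\<^sub>k - x\<^sub>k q\<^sub>k\<close>,
  the product over the points of \<open>V\<close> above \<open>t\<close>, is up to a constant monic in \<open>t\<close>.
  Given \<open>y\<close> outside the image, at each of the finitely many points of \<open>V\<close> above the roots of \<open>R(y, t)\<close>
  some \<open>p\<^sub>i - y\<^sub>i q\<^sub>i\<close> is nonzero, because \<open>p\<^sub>i\<close> and \<open>q\<^sub>i\<close> have no common zero on \<open>V\<close>. So a generic linear
  combination \<open>h\<close> of the \<open>p\<^sub>i - x\<^sub>i q\<^sub>i\<close> does not vanish at any of these points for \<open>x = y\<close>.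
  Eliminating \<open>t\<close> between \<open>R\<close> and the norm of \<open>h\<close> gives a polynomial in \<open>x\<close> that vanishes on the
  image but not at \<open>y\<close>.\<close>

hide_const (open) up_ring.monom up_ring.coeff module.smult Polynomials.degree Polynomials.lead_coeff

section \<open>Rings of polynomial functions\<close>

text \<open>The algebra generated by \<open>B\<close>. Norms and determinants are defined pointwise
  and placed in such an algebra by closure rules; \<open>polyfuns_imp_mpoly\<close> finally turns a
  member into a polynomial.\<close>

inductive_set polyfuns :: "('s \<Rightarrow> complex) set \<Rightarrow> ('s \<Rightarrow> complex) set"
  for B :: "('s \<Rightarrow> complex) set" where
  const: "(\<lambda>_. c) \<in> polyfuns B"
| gen: "f \<in> B \<Longrightarrow> f \<in> polyfuns B"
| add: "f \<in> polyfuns B \<Longrightarrow> h \<in> polyfuns B \<Longrightarrow> (\<lambda>s. f s + h s) \<in> polyfuns B"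
| mult: "f \<in> polyfuns B \<Longrightarrow> h \<in> polyfuns B \<Longrightarrow> (\<lambda>s. f s * h s) \<in> polyfuns B"

lemma polyfuns_cong:
  assumes "f \<in> polyfuns B" "\<And>b. b \<in> B \<Longrightarrow> b s = b s'" shows "f s = f s'"
  using assms by (induction rule: polyfuns.induct) auto

lemma polyfuns_minus:
  "f \<in> polyfuns B \<Longrightarrow> h \<in> polyfuns B \<Longrightarrow> (\<lambda>s. f s - h s) \<in> polyfuns B"
  using polyfuns.add[of f B "\<lambda>s. - 1 * h s"] polyfuns.mult[OF polyfuns.const, of h B "- 1"] by simp

lemma polyfuns_sum:
  "(\<And>i. i \<in> I \<Longrightarrow> f i \<in> polyfuns B) \<Longrightarrow> (\<lambda>s. \<Sum>i\<in>I. f i s) \<in> polyfuns B"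
  by (induction I rule: infinite_finite_induct) (auto intro: polyfuns.intros)

lemma polyfuns_prod:
  "(\<And>i. i \<in> I \<Longrightarrow> f i \<in> polyfuns B) \<Longrightarrow> (\<lambda>s. \<Prod>i\<in>I. f i s) \<in> polyfuns B"
  by (induction I rule: infinite_finite_induct) (auto intro: polyfuns.intros)

lemma polyfuns_power: "f \<in> polyfuns B \<Longrightarrow> (\<lambda>s. f s ^ n) \<in> polyfuns B"
  by (induction n) (auto intro: polyfuns.intros)

text \<open>Encodes a polynomial in one further variable over \<open>polyfuns B\<close>. The degree
  may drop at special \<open>s\<close>, so only a uniform bound is asked; it makes finitely many
  coefficient functions suffice.\<close>

definition poly_family :: "('s \<Rightarrow> complex) set \<Rightarrow> ('s \<Rightarrow> complex poly) \<Rightarrow> bool" where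
  "poly_family B P \<longleftrightarrow>
     (\<exists>n. \<forall>s. degree (P s) \<le> n) \<and> (\<forall>i. (\<lambda>s. coeff (P s) i) \<in> polyfuns B)"

lemma poly_familyI:
  "(\<And>s. degree (P s) \<le> n) \<Longrightarrow> (\<And>i. (\<lambda>s. coeff (P s) i) \<in> polyfuns B) \<Longrightarrow> poly_family B P"
  unfolding poly_family_def by blast

lemma poly_family_coeff: "poly_family B P \<Longrightarrow> (\<lambda>s. coeff (P s) i) \<in> polyfuns B"
  unfolding poly_family_def by blast

lemma poly_family_bound:
  assumes "poly_family B P" obtains n where "\<And>s. degree (P s) \<le> n"
  using assms unfolding poly_family_def by blast

lemma poly_family_const: "poly_family B (\<lambda>_. p)"
  by (rule poly_familyI[of _ "degree p"]) (auto intro: polyfuns.const)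

lemma poly_family_coeff_poly: "f \<in> polyfuns B \<Longrightarrow> poly_family B (\<lambda>s. [:f s:])"
proof (rule poly_familyI[of _ 0])
  fix i assume "f \<in> polyfuns B"
  then show "(\<lambda>s. coeff [:f s:] i) \<in> polyfuns B"
    by (cases i) (simp_all add: polyfuns.const)
qed simp

lemma poly_family_add:
  assumes "poly_family B P" "poly_family B Q" shows "poly_family B (\<lambda>s. P s + Q s)"
proof -
  obtain n k where "\<And>s. degree (P s) \<le> n" "\<And>s. degree (Q s) \<le> k"
    using assms by (metis poly_family_bound)
  then have "degree (P s + Q s) \<le> max n k" for s
    by (intro degree_add_le) (simp_all add: max.coboundedI1 max.coboundedI2)
  then show ?thesis
    by (rule poly_familyI) (auto intro!: polyfuns.add poly_family_coeff assms)
qed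

lemma poly_family_mult:
  assumes "poly_family B P" "poly_family B Q" shows "poly_family B (\<lambda>s. P s * Q s)"
proof -
  obtain n k where nk: "\<And>s. degree (P s) \<le> n" "\<And>s. degree (Q s) \<le> k"
    using assms by (metis poly_family_bound)
  show ?thesis
  proof (rule poly_familyI)
    show "degree (P s * Q s) \<le> n + k" for s
      using degree_mult_le[of "P s" "Q s"] nk[of s] by linarith
    show "(\<lambda>s. coeff (P s * Q s) i) \<in> polyfuns B" for i
      unfolding coeff_mult
      by (intro polyfuns_sum polyfuns.mult poly_family_coeff assms)
  qed
qed

lemma poly_family_smult:
  "f \<in> polyfuns B \<Longrightarrow> poly_family B P \<Longrightarrow> poly_family B (\<lambda>s. smult (f s) (P s))"
  using poly_family_mult[OF poly_family_coeff_poly] by fastforce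

lemma poly_family_minus:
  assumes "poly_family B P" "poly_family B Q" shows "poly_family B (\<lambda>s. P s - Q s)"
  using poly_family_add[OF assms(1) poly_family_smult[OF polyfuns.const assms(2), of "- 1"]] by simp

lemma poly_family_prod:
  "(\<And>i. i \<in> I \<Longrightarrow> poly_family B (P i)) \<Longrightarrow> poly_family B (\<lambda>s. \<Prod>i\<in>I. P i s)"
  by (induction I rule: infinite_finite_induct) (auto intro: poly_family_const poly_family_mult)

lemma poly_family_pcompose_linear:
  assumes "poly_family B P" shows "poly_family B (\<lambda>s. pcompose (P s) [:0, c:])"
proof -
  obtain n where n: "\<And>s. degree (P s) \<le> n" using poly_family_bound[OF assms] by blast
  show ?thesis
  proof (rule poly_familyI)
    show "degree (pcompose (P s) [:0, c:]) \<le> n" for s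
      using degree_pcompose_le[of "P s" "[:0, c:]"] n[of s]
      by (simp split: if_splits)
    show "(\<lambda>s. coeff (pcompose (P s) [:0, c:]) i) \<in> polyfuns B" for i
      unfolding coeff_pcompose_linear
      by (intro polyfuns.mult polyfuns.const poly_family_coeff assms)
  qed
qed

lemma poly_eq_sum_atMost:
  fixes p :: "complex poly"
  shows "degree p \<le> n \<Longrightarrow> poly p x = (\<Sum>i\<le>n. coeff p i * x ^ i)"
  by (simp add: poly_altdef) (rule sum.mono_neutral_left, auto simp: coeff_eq_0 not_le)

text \<open>Collects powers of the generator \<open>u\<close>. It serves to peel off the topmost
  \<open>\<Delta>\<close> in the norm induction, and \<open>t\<close> at the end.\<close>

lemma polyfuns_insert_expand:
  assumes "f \<in> polyfuns (insert u B)"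
  obtains P where "poly_family B P" "\<And>s. f s = poly (P s) (u s)"
proof -
  have "\<exists>P. poly_family B P \<and> (\<forall>s. f s = poly (P s) (u s))" using assms
  proof (induction rule: polyfuns.induct)
    case (const c)
    show ?case by (rule exI[of _ "\<lambda>_. [:c:]"]) (auto intro: poly_family_const)
  next
    case (gen f)
    show ?case
    proof (cases "f = u")
      case True
      then show ?thesis by (intro exI[of _ "\<lambda>_. [:0, 1:]"]) (auto intro: poly_family_const)
    next
      case False
      then show ?thesis using gen
        by (intro exI[of _ "\<lambda>s. [:f s:]"]) (auto intro: poly_family_coeff_poly polyfuns.gen)
    qed
  next
    case (add f h)
    then obtain P Q where "poly_family B P" "poly_family B Q"
      "\<And>s. f s = poly (P s) (u s)" "\<And>s. h s = poly (Q s) (u s)" by blast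
    then show ?case by (intro exI[of _ "\<lambda>s. P s + Q s"]) (simp add: poly_family_add)
  next
    case (mult f h)
    then obtain P Q where "poly_family B P" "poly_family B Q"
      "\<And>s. f s = poly (P s) (u s)" "\<And>s. h s = poly (Q s) (u s)" by blast
    then show ?case by (intro exI[of _ "\<lambda>s. P s * Q s"]) (simp add: poly_family_mult)
  qed
  then show ?thesis using that by blast
qed

section \<open>Elimination of a variable by a monic polynomial\<close>

text \<open>Long division by a monic polynomial of constant degree never divides by a coefficient,
  so the remainder keeps its coefficients in the algebra.\<close>

lemma poly_family_mod_monic:
  assumes M: "poly_family B M" "\<And>s. degree (M s) = d" "\<And>s. lead_coeff (M s) = 1"
    and F: "poly_family B F"
  shows "poly_family B (\<lambda>s. F s mod M s)"
proof -
  obtain n where "\<And>s. degree (F s) < n" using poly_family_bound[OF F] by (metis le_imp_less_Suc)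
  then show ?thesis using F
  proof (induction n arbitrary: F)
    case 0
    then show ?case by simp
  next
    case (Suc n)
    show ?case
    proof (cases "n < d")
      case True
      then have "F s mod M s = F s" for s
        using Suc.prems(1)[of s] M(2)[of s] by (intro mod_poly_less) simp
      then show ?thesis using Suc.prems(2) by simp
    next
      case False
      \<comment> \<open>One division step: the coefficient of index \<open>n\<close>, the highest
        that can occur, is cancelled without changing the remainder.\<close>
      define F' where "F' = (\<lambda>s. F s - smult (coeff (F s) n) (monom 1 (n - d) * M s))"
      have fam: "poly_family B F'" unfolding F'_def
        by (intro poly_family_minus poly_family_smult poly_family_mult poly_family_const M(1)
            poly_family_coeff Suc.prems(2))
      have c0: "coeff (F' s) i = 0" if "i \<ge> n" for s i
      proof (cases "i = n")
        case True
        then show ?thesis using False M(2,3)[of s] by (simp add: F'_def coeff_monom_mult)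
      next
        case neq: False
        have "coeff (F s) i = 0" using Suc.prems(1)[of s] neq that by (intro coeff_eq_0) simp
        moreover have "coeff (M s) (i - (n - d)) = 0"
          using M(2)[of s] neq that False by (intro coeff_eq_0) simp
        ultimately show ?thesis by (simp add: F'_def coeff_monom_mult)
      qed
      have modeq: "F' s mod M s = F s mod M s" for s
      proof -
        have "F' s = F s + - smult (coeff (F s) n) (monom 1 (n - d)) * M s"
          by (simp add: F'_def)
        then show ?thesis by (metis mod_mult_self1)
      qed
      show ?thesis
      proof (cases "n = 0")
        \<comment> \<open>No degree is below \<open>0\<close>, so the induction hypothesis cannot
          apply here; but then nothing is left of \<open>F' s\<close>.\<close>
        case True
        have "F' s = 0" for s using c0[of _ s] True by (intro poly_eqI) simp
        then have "F s mod M s = 0" for s using modeq[of s] by simp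
        then show ?thesis by (simp add: poly_family_const)
      next
        case n0: False
        have "degree (F' s) < n" for s
          using degree_le[of "n - 1" "F' s"] c0[of _ s] n0 by fastforce
        from Suc.IH[OF this fam] show ?thesis by (simp add: modeq)
      qed
    qed
  qed
qed

text \<open>A common divisor has no root at all, hence is constant by the fundamental theorem of
  algebra.\<close>

lemma coprime_if_no_common_root:
  fixes p q :: "complex poly"
  assumes "p \<noteq> 0" "\<And>x. poly p x = 0 \<Longrightarrow> poly q x \<noteq> 0"
  shows "coprime p q"
proof (rule coprimeI)
  fix c assume "c dvd p" "c dvd q"
  then have "poly c x \<noteq> 0" for x using assms(2) by (metis dvdE mult_eq_0_iff poly_mult)
  then have "degree c = 0"
    using fundamental_theorem_of_algebra[of c] by (auto simp: constant_degree)
  moreover have "c \<noteq> 0" using \<open>c dvd p\<close> assms(1) by auto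
  ultimately show "is_unit c" by (simp add: is_unit_iff_degree)
qed

text \<open>The witness is the determinant of multiplication by \<open>H s\<close> modulo \<open>M s\<close>.\<close>

lemma monic_elimination:
  assumes M: "poly_family B M" "\<And>s. degree (M s) = d" "\<And>s. lead_coeff (M s) = 1"
    and H: "poly_family B H"
  obtains f where "f \<in> polyfuns B"
    "\<And>s. f s = 0 \<longleftrightarrow> (\<exists>x. poly (M s) x = 0 \<and> poly (H s) x = 0)"
proof
  let ?R = "\<lambda>a s. monom 1 a * H s mod M s"
  \<comment> \<open>Column \<open>a\<close> lists the coefficients of the remainder of
    \<open>T^a * H s\<close>, so \<open>A s\<close> is the multiplication matrix in the basis
    \<open>1, T, ..., T^(d-1)\<close>.\<close>
  define A where "A s = mat d d (\<lambda>(b, a). coeff (?R a s) b)" for s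
  let ?f = "\<lambda>s. det (A s)"
  have A[simp]: "A s \<in> carrier_mat d d" for s by (simp add: A_def)
  have "?f = (\<lambda>s. \<Sum>\<pi>\<in>{\<pi>. \<pi> permutes {0..<d}}.
      signof \<pi> * (\<Prod>b = 0..<d. coeff (?R (\<pi> b) s) b))"
    unfolding det_def
    by (auto simp: A_def permutes_in_image intro!: sum.cong prod.cong arg_cong[of _ _ "(*) _"])
  also have "\<dots> \<in> polyfuns B"
    by (intro polyfuns_sum polyfuns.mult polyfuns.const polyfuns_prod poly_family_coeff
        poly_family_mod_monic[OF M] poly_family_mult poly_family_const H)
  finally show "?f \<in> polyfuns B" .
  fix s
  have M0: "M s \<noteq> 0" using M(3)[of s] by auto
  show "?f s = 0 \<longleftrightarrow> (\<exists>x. poly (M s) x = 0 \<and> poly (H s) x = 0)"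
  proof
    assume "?f s = 0"
    then obtain v where v: "v \<in> carrier_vec d" "v \<noteq> 0\<^sub>v d" "A s *\<^sub>v v = 0\<^sub>v d"
      using det_0_iff_vec_prod_zero[OF A] by blast
    \<comment> \<open>The kernel vector, read as coefficients, is a nonzero polynomial of degree
      below \<open>d\<close> whose product with \<open>H s\<close> is divisible by
      \<open>M s\<close>. Without a common root, \<open>M s\<close> would have to divide
      \<open>W\<close> itself.\<close>
    define W where "W = (\<Sum>a<d. monom (vec_index v a) a)"
    have cW: "coeff W a = (if a < d then vec_index v a else 0)" for a
      by (simp add: W_def coeff_sum)
    have "W \<noteq> 0"
    proof
      assume "W = 0"
      then have "vec_index v a = 0" if "a < d" for a using cW[of a] that by simp
      then have "v = 0\<^sub>v d" using v(1) by (intro eq_vecI) auto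
      then show False using v(2) by contradiction
    qed
    have "W * H s mod M s = (\<Sum>a<d. smult (vec_index v a) (?R a s))"
    proof -
      have "W * H s = (\<Sum>a<d. smult (vec_index v a) (monom 1 a * H s))"
        unfolding W_def sum_distrib_right
        by (intro sum.cong refl) (simp flip: mult_smult_left add: smult_monom)
      moreover have "(\<Sum>a\<in>I. F a) mod M s = (\<Sum>a\<in>I. F a mod M s)"
        for F :: "nat \<Rightarrow> complex poly" and I
        by (induction I rule: infinite_finite_induct) (simp_all add: poly_mod_add_left)
      ultimately show ?thesis by (simp add: mod_smult_left)
    qed
    also have "\<dots> = 0"
    proof (rule poly_eqI)
      fix b
      show "coeff (\<Sum>a<d. smult (vec_index v a) (?R a s)) b = coeff 0 b"
      proof (cases "b < d")
        case True
        have dv: "dim_vec v = d" using v(1) by (rule carrier_vecD)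
        have "vec_index (A s *\<^sub>v v) b = (\<Sum>a = 0..<d. coeff (?R a s) b * vec_index v a)"
          using True by (simp add: A_def scalar_prod_def dv)
        then have "(\<Sum>a = 0..<d. coeff (?R a s) b * vec_index v a) = 0"
          unfolding v(3) using True by simp
        then show ?thesis by (simp add: coeff_sum atLeast0LessThan mult.commute)
      next
        case False
        have "coeff (?R a s) b = 0" for a
        proof (cases "?R a s = 0")
          case False
          then have "degree (?R a s) < d"
            using degree_mod_less[OF M0, of "monom 1 a * H s"] M(2)[of s] by simp
          then show ?thesis using \<open>\<not> b < d\<close> by (intro coeff_eq_0) simp
        qed simp
        then show ?thesis by (simp add: coeff_sum)
      qed
    qed
    finally have dvd: "M s dvd W * H s" by (simp add: mod_eq_0_iff_dvd)
    show "\<exists>x. poly (M s) x = 0 \<and> poly (H s) x = 0"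
    proof (rule ccontr)
      assume "\<not> ?thesis"
      then have "coprime (M s) (H s)" using M0 by (intro coprime_if_no_common_root) auto
      then have "M s dvd W" using dvd by (simp add: coprime_dvd_mult_left_iff)
      then have "d \<le> degree W" using dvd_imp_degree_le[of "M s" W] \<open>W \<noteq> 0\<close> M(2)[of s] by simp
      moreover have "coeff W (degree W) \<noteq> 0" using \<open>W \<noteq> 0\<close> by simp
      ultimately show False using cW[of "degree W"] by simp
    qed
  next
    assume "\<exists>x. poly (M s) x = 0 \<and> poly (H s) x = 0"
    then obtain x where x: "poly (M s) x = 0" "poly (H s) x = 0" by blast
    have d0: "d > 0"
    proof (rule ccontr)
      assume "\<not> d > 0"
      then have "degree (M s) = 0" using M(2) by simp
      then obtain c where "M s = [:c:]" by (rule degree_eq_zeroE)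
      then show False using x(1) M0 by simp
    qed
    \<comment> \<open>Pairing the powers of a common root \<open>x\<close> with column
      \<open>a\<close> evaluates the remainder of \<open>T^a * H s\<close> at \<open>x\<close>,
      which gives \<open>0\<close>. The entry \<open>x^0 = 1\<close> makes the vector
      nonzero.\<close>
    define v where "v = vec d (\<lambda>b. x ^ b)"
    have "vec_index v 0 \<noteq> vec_index (0\<^sub>v d) 0" using d0 by (simp add: v_def)
    then have v0: "v \<noteq> 0\<^sub>v d" by metis
    have "transpose_mat (A s) *\<^sub>v v = 0\<^sub>v d"
    proof (rule eq_vecI)
      fix a assume "a < dim_vec (0\<^sub>v d :: complex vec)"
      then have a: "a < d" by simp
      have "poly (?R a s) x = poly (monom 1 a * H s) x"
        using x(1) poly_mod[of "M s" x "monom 1 a * H s"] by simp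
      also have "\<dots> = 0" using x(2) by simp
      finally have "poly (?R a s) x = 0" .
      moreover have "degree (?R a s) \<le> d - 1"
        using degree_mod_less[OF M0, of "monom 1 a * H s"] M(2)[of s] by auto
      ultimately have "(\<Sum>b\<le>d - 1. coeff (?R a s) b * x ^ b) = 0"
        by (simp flip: poly_eq_sum_atMost)
      moreover have "{..d - 1} = {0..<d}" using d0 by auto
      ultimately show "vec_index (transpose_mat (A s) *\<^sub>v v) a = vec_index (0\<^sub>v d) a"
        using a by (auto simp: A_def v_def scalar_prod_def)
    qed (simp add: A_def)
    then have "det (transpose_mat (A s)) = 0"
      using det_0_iff_vec_prod_zero[of "transpose_mat (A s)" d] v0 vec_carrier[of d] v_def
      by (metis A transpose_carrier_mat)
    then show "?f s = 0" by (simp add: det_transpose[OF A])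
  qed
qed

section \<open>Evaluation of multivariate polynomials\<close>

lemma mpoly_eval_superset:
  assumes "finite K" "monomials f \<subseteq> K"
  shows "mpoly_eval f v = (\<Sum>\<mu>\<in>K. mcoeff f \<mu> * (\<Prod>k\<in>mvars \<mu>. v k ^ expo \<mu> k))"
  unfolding eval_via_def id_apply using assms
  by (intro sum.mono_neutral_left) (auto simp: in_keys_iff)

lemma mpoly_eval_add: "mpoly_eval (f + h) v = mpoly_eval f v + mpoly_eval h v"
proof -
  let ?K = "monomials f \<union> monomials h"
  have "monomials (f + h) \<subseteq> ?K" by (rule Poly_Mapping.keys_add)
  then show ?thesis
    by (simp add: mpoly_eval_superset[of ?K] lookup_add distrib_right sum.distrib)
qed

lemma mpoly_eval_single:
  "mpoly_eval (Poly_Mapping.single \<mu> c) v = c * (\<Prod>k\<in>mvars \<mu>. v k ^ expo \<mu> k)"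
  by (simp add: eval_via_def)

lemma mpoly_eval_0 [simp]: "mpoly_eval 0 v = 0"
  by (simp add: eval_via_def)

lemma mpoly_eval_1 [simp]: "mpoly_eval 1 v = 1"
  by (simp add: eval_via_def)

lemma mpoly_eval_sum: "mpoly_eval (\<Sum>i\<in>I. f i) v = (\<Sum>i\<in>I. mpoly_eval (f i) v)"
  using sum_comp_morphism[of "\<lambda>f. mpoly_eval f v" f I] by (simp add: mpoly_eval_add o_def)

lemma mpoly_eval_uminus: "mpoly_eval (- f) v = - mpoly_eval f v"
  using mpoly_eval_add[of f "- f" v] by (simp add: add_eq_0_iff)

lemma mpoly_eval_diff: "mpoly_eval (f - h) v = mpoly_eval f v - mpoly_eval h v"
  using mpoly_eval_add[of f "- h" v] by (simp add: mpoly_eval_uminus)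

lemma monomial_eval_superset:
  fixes v :: "'v \<Rightarrow> complex"
  assumes "finite K" "mvars \<mu> \<subseteq> K"
  shows "(\<Prod>k\<in>mvars \<mu>. v k ^ expo \<mu> k) = (\<Prod>k\<in>K. v k ^ expo \<mu> k)"
  using assms by (intro prod.mono_neutral_left) (auto simp: in_keys_iff)

lemma monomial_eval_add:
  fixes v :: "'v \<Rightarrow> complex"
  shows "(\<Prod>k\<in>mvars (\<mu> + \<nu>). v k ^ expo (\<mu> + \<nu>) k)
    = (\<Prod>k\<in>mvars \<mu>. v k ^ expo \<mu> k) * (\<Prod>k\<in>mvars \<nu>. v k ^ expo \<nu> k)"
proof -
  let ?K = "mvars \<mu> \<union> mvars \<nu>"
  have "mvars (\<mu> + \<nu>) \<subseteq> ?K" by (rule Poly_Mapping.keys_add)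
  then have "(\<Prod>k\<in>mvars (\<mu> + \<nu>). v k ^ expo (\<mu> + \<nu>) k) = (\<Prod>k\<in>?K. v k ^ expo (\<mu> + \<nu>) k)"
    by (intro monomial_eval_superset) simp_all
  then show ?thesis
    by (simp add: monomial_eval_superset[of ?K \<mu>] monomial_eval_superset[of ?K \<nu>] lookup_add
        power_add prod.distrib)
qed

lemma mpoly_sum_monomials:
  "f = (\<Sum>\<mu>\<in>monomials f. Poly_Mapping.single \<mu> (mcoeff f \<mu>))"
  by (rule poly_mapping_eqI) (auto simp: lookup_sum lookup_single when_def in_keys_iff)

lemma mpoly_eval_mult: "mpoly_eval (f * h) v = mpoly_eval f v * mpoly_eval h v"
proof -
  have "f * h = (\<Sum>\<mu>\<in>monomials f. \<Sum>\<nu>\<in>monomials h.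
      Poly_Mapping.single (\<mu> + \<nu>) (mcoeff f \<mu> * mcoeff h \<nu>))"
    by (subst mpoly_sum_monomials[of f], subst mpoly_sum_monomials[of h])
      (simp add: sum_product mult_single)
  then show ?thesis
    by (simp add: mpoly_eval_sum mpoly_eval_single monomial_eval_add)
      (simp add: eval_via_def sum_product mult_ac)
qed

lemma mpoly_eval_cong:
  assumes "\<And>k. k \<in> vars f \<Longrightarrow> v k = w k" shows "mpoly_eval f v = mpoly_eval f w"
  unfolding eval_via_def
  by (intro sum.cong prod.cong refl arg_cong2[of _ _ _ _ "(*)"] arg_cong[of _ _ "\<lambda>x. x ^ _"] assms)
    (auto simp: vars_def)

lemma mpoly_eval_rad_poly: "mpoly_eval (rad_poly e g i) v = v i ^ e i - mpoly_eval (g i) v"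
  by (cases "e i = 0") (simp_all add: rad_poly_def mpoly_eval_diff mpoly_eval_single)

lemma polyfuns_mpoly_eval:
  assumes "\<And>k. k \<in> vars f \<Longrightarrow> (\<lambda>s. v s k) \<in> polyfuns B"
  shows "(\<lambda>s. mpoly_eval f (v s)) \<in> polyfuns B"
  unfolding eval_via_def id_apply
  by (intro polyfuns_sum polyfuns.mult polyfuns.const polyfuns_prod polyfuns_power assms)
    (auto simp: vars_def)

lemma polyfuns_imp_mpoly:
  fixes v :: "'a \<Rightarrow> 'b \<Rightarrow> complex"
  assumes "f \<in> polyfuns (range (\<lambda>k s. v s k))"
  obtains \<phi> where "\<And>s. f s = mpoly_eval \<phi> (v s)"
proof -
  define ev where "ev = (mpoly_eval :: 'b mpoly \<Rightarrow> _)"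
  have "\<exists>\<phi>. \<forall>s. f s = ev \<phi> (v s)" using assms
  proof (induction rule: polyfuns.induct)
    case (const c)
    show ?case by (rule exI[of _ "Poly_Mapping.single 0 c"]) (simp add: ev_def mpoly_eval_single)
  next
    case (gen f)
    then obtain k where "f = (\<lambda>s. v s k)" by blast
    then show ?case
      by (intro exI[of _ "Poly_Mapping.single (Poly_Mapping.single k 1) 1"])
        (simp add: ev_def mpoly_eval_single)
  next
    case (add f h)
    then obtain \<phi> \<psi> where "\<And>s. f s = ev \<phi> (v s)" "\<And>s. h s = ev \<psi> (v s)" by blast
    then show ?case by (intro exI[of _ "\<phi> + \<psi>"]) (simp add: ev_def mpoly_eval_add)
  next
    case (mult f h)
    then obtain \<phi> \<psi> where "\<And>s. f s = ev \<phi> (v s)" "\<And>s. h s = ev \<psi> (v s)" by blast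
    then show ?case by (intro exI[of _ "\<phi> * \<psi>"]) (simp add: ev_def mpoly_eval_mult)
  qed
  then show ?thesis using that by (auto simp: ev_def)
qed

section \<open>Norms along a radical tower\<close>

definition unity_root :: "nat \<Rightarrow> complex" where
  "unity_root n = cis (2 * pi / n)"

text \<open>For \<open>n > 0\<close> these are the roots of \<open>z^n = w\<close> with
  multiplicity: \<open>w = 0\<close> gives \<open>n\<close> copies of \<open>0\<close>. A product
  over the list is therefore a norm also at branch points.\<close>

definition root_list :: "nat \<Rightarrow> complex \<Rightarrow> complex list" where
  "root_list n w = map (\<lambda>l. unity_root n ^ l * (SOME z. z ^ n = w)) [0..<n]"

lemma unity_root_power: "unity_root n ^ l = cis (2 * pi * l / n)"
  by (simp add: unity_root_def Complex.DeMoivre mult_ac)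

lemma unity_root_power_eq_1_iff:
  assumes "n > 0" shows "unity_root n ^ l = 1 \<longleftrightarrow> n dvd l"
proof -
  have "unity_root n ^ l = exp (2 * of_real pi * \<i> * of_nat l / of_nat n)"
    by (simp add: unity_root_power cis_conv_exp mult_ac)
  then show ?thesis using complex_root_unity_eq_1[of n l] assms by simp
qed

lemma some_root: 
  assumes "n > 0" shows "(SOME z :: complex. z ^ n = w) ^ n = w"
proof -
  have "\<exists>z :: complex. z ^ n = w"
  proof (cases "w = 0")
    case True
    then show ?thesis using assms by (intro exI[of _ 0]) simp
  next
    case False
    have "card {z :: complex. z ^ n = w} = n" using False assms by (rule card_nth_roots)
    then have "{z :: complex. z ^ n = w} \<noteq> {}" using assms by (intro notI) simp
    then show ?thesis by blast
  qed
  then show ?thesis by (rule someI_ex)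
qed

lemma set_root_list:
  assumes "n > 0" shows "set (root_list n w) = {z. z ^ n = w}"
proof (intro equalityI subsetI)
  fix z assume "z \<in> set (root_list n w)"
  moreover have "(unity_root n ^ l) ^ n = 1" for l
    using unity_root_power_eq_1_iff[OF assms, of "l * n"] by (simp add: power_mult)
  ultimately show "z \<in> {z. z ^ n = w}"
    using some_root[OF assms, of w] by (auto simp: root_list_def power_mult_distrib)
next
  fix z assume "z \<in> {z. z ^ n = w}"
  then have z: "z ^ n = w" by simp
  define r where "r = (SOME z :: complex. z ^ n = w)"
  have r: "r ^ n = w" unfolding r_def by (rule some_root[OF assms])
  have "\<exists>l<n. z = unity_root n ^ l * r"
  proof (cases "w = 0")
    case True
    then have "z = 0" "r = 0" using z r by simp_all
    then show ?thesis using assms by auto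
  next
    case False
    then have "r \<noteq> 0" using r assms by auto
    have "(z / r) ^ n = 1" using z r False by (simp add: power_divide)
    then have "z / r \<in> (\<lambda>k. cis (2 * pi * real k / real n)) ` {..<n}"
      using bij_betw_imp_surj_on[OF Complex.bij_betw_roots_unity[OF assms]] by auto
    then obtain l where "l < n" "z / r = unity_root n ^ l" by (auto simp: unity_root_power)
    then show ?thesis using \<open>r \<noteq> 0\<close> by (auto simp: field_simps)
  qed
  then show "z \<in> set (root_list n w)" by (auto simp: root_list_def r_def)
qed

lemma length_root_list [simp]: "length (root_list n w) = n"
  by (simp add: root_list_def)

text \<open>The product of \<open>P(\<zeta>\<^sup>l T)\<close> over all \<open>l\<close> is invariant under \<open>T \<mapsto> \<zeta> T\<close>, hence a
  polynomial in \<open>T\<^sup>n\<close>.\<close>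

lemma polyfuns_prod_root_list:
  assumes n: "n > 0" and P: "poly_family B P" and u: "u \<in> polyfuns B"
  shows "(\<lambda>s. \<Prod>z\<leftarrow>root_list n (u s). poly (P s) z) \<in> polyfuns B"
proof -
  let ?z = "unity_root n"
  define f where "f s l = pcompose (P s) [:0, ?z ^ l:]" for s l
  define G where "G s = (\<Prod>l<n. f s l)" for s
  have fam: "poly_family B G" unfolding G_def f_def
    by (intro poly_family_prod poly_family_pcompose_linear P)
  have step: "pcompose (f s l) [:0, ?z:] = f s (Suc l)" for s l
    by (simp add: f_def pcompose_pCons mult.commute flip: pcompose_assoc)
  have cyc: "f s n = f s 0" for s
    using unity_root_power_eq_1_iff[OF n, of n] by (simp add: f_def)
  \<comment> \<open>The substitution moves the factor of index \<open>l\<close> to index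
    \<open>l + 1\<close>, and index \<open>n\<close> is index \<open>0\<close> again.\<close>
  have inv: "pcompose (G s) [:0, ?z:] = G s" for s
  proof -
    obtain k where k: "n = Suc k" using n gr0_implies_Suc by blast
    have "pcompose (G s) [:0, ?z:] = (\<Prod>l<n. f s (Suc l))"
      by (simp add: G_def pcompose_prod step)
    also have "\<dots> = G s" unfolding G_def k prod.lessThan_Suc_shift[of "f s"]
      using cyc[of s] k by (simp add: mult.commute)
    finally show ?thesis .
  qed
  \<comment> \<open>Invariance multiplies the coefficient of index \<open>i\<close> by the
    \<open>i\<close>-th power of the root of unity, which is \<open>1\<close> only if
    \<open>n\<close> divides \<open>i\<close>.\<close>
  have zero: "coeff (G s) i = 0" if "\<not> n dvd i" for s i
  proof -
    have "?z ^ i * coeff (G s) i = coeff (G s) i"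
      using arg_cong[OF inv[of s], of "\<lambda>p. coeff p i"] by (simp add: coeff_pcompose_linear)
    then show ?thesis using unity_root_power_eq_1_iff[OF n, of i] that by auto
  qed
  obtain N where N: "\<And>s. degree (G s) \<le> N" using poly_family_bound[OF fam] by blast
  \<comment> \<open>The exponent \<open>i div n\<close> is exact where the coefficient can be
    nonzero. Only \<open>r ^ n = u s\<close> enters the result, so the arbitrary choice of the root
    \<open>r\<close> disappears.\<close>
  have "(\<Prod>z\<leftarrow>root_list n (u s). poly (P s) z)
      = (\<Sum>i\<le>N. coeff (G s) i * u s ^ (i div n))" for s
  proof -
    define r where "r = (SOME z :: complex. z ^ n = u s)"
    have r: "r ^ n = u s" unfolding r_def by (rule some_root[OF n])
    have "(\<Prod>z\<leftarrow>root_list n (u s). poly (P s) z) = (\<Prod>l<n. poly (P s) (?z ^ l * r))"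
      by (simp add: root_list_def r_def[symmetric] o_def prod.list_conv_set_nth atLeast0LessThan)
    also have "\<dots> = poly (G s) r"
      by (simp add: G_def f_def poly_prod poly_pcompose mult.commute)
    also have "\<dots> = (\<Sum>i\<le>N. coeff (G s) i * r ^ i)" by (rule poly_eq_sum_atMost[OF N])
    also have "\<dots> = (\<Sum>i\<le>N. coeff (G s) i * u s ^ (i div n))"
    proof (intro sum.cong refl)
      fix i
      show "coeff (G s) i * r ^ i = coeff (G s) i * u s ^ (i div n)"
      proof (cases "n dvd i")
        case True
        then have "r ^ i = u s ^ (i div n)" by (metis dvd_mult_div_cancel power_mult r)
        then show ?thesis by simp
      qed (simp add: zero)
    qed
    finally show ?thesis .
  qed
  moreover have "(\<lambda>s. \<Sum>i\<le>N. coeff (G s) i * u s ^ (i div n)) \<in> polyfuns B"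
    by (intro polyfuns_sum polyfuns.mult polyfuns_power u poly_family_coeff[OF fam])
  ultimately show ?thesis by simp
qed

section \<open>The tower variety and its fibres over the \<open>t\<close>-line\<close>

definition triangular :: "(nat \<Rightarrow> nat) \<Rightarrow> (nat \<Rightarrow> nat mpoly) \<Rightarrow> nat \<Rightarrow> bool" where
  "triangular e g m \<longleftrightarrow> (\<forall>i\<in>{1..m}. e i > 0 \<and> vars (g i) \<subseteq> {..<i})"

definition tower_variety :: "(nat \<Rightarrow> nat) \<Rightarrow> (nat \<Rightarrow> nat mpoly) \<Rightarrow> nat \<Rightarrow> (nat \<Rightarrow> complex) set" where
  "tower_variety e g m = {v. \<forall>i\<in>{1..m}. v i ^ e i = mpoly_eval (g i) v}"

text \<open>The points of the tower variety over \<open>t = v 0\<close>, with multiplicities. The coordinates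
  beyond \<open>m\<close> are copied from \<open>v\<close>.\<close>

primrec fibre :: "(nat \<Rightarrow> nat) \<Rightarrow> (nat \<Rightarrow> nat mpoly) \<Rightarrow> nat \<Rightarrow> (nat \<Rightarrow> complex) \<Rightarrow> (nat \<Rightarrow> complex) list"
  where
  "fibre e g 0 v = [v]"
| "fibre e g (Suc m) v = concat (map (\<lambda>w. map (\<lambda>z. w(Suc m := z))
     (root_list (e (Suc m)) (mpoly_eval (g (Suc m)) w))) (fibre e g m v))"

lemma triangular_Suc: "triangular e g (Suc m) \<Longrightarrow> triangular e g m"
  by (simp add: triangular_def)

lemma triangularD:
  assumes "triangular e g m" "1 \<le> i" "i \<le> m" shows "e i > 0" "vars (g i) \<subseteq> {..<i}"
  using assms by (simp_all add: triangular_def)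

text \<open>The length is the same for all \<open>v\<close>, so the fibres over all \<open>t\<close>
  can be indexed by one range, as \<open>norm_lead_coeff\<close> does.\<close>

lemma length_fibre: "length (fibre e g m v) = (\<Prod>i\<in>{1..m}. e i)"
  by (induction m) (simp_all add: length_concat o_def sum_list_triv mult.commute)

text \<open>Each \<open>g i\<close> with \<open>i\<close> up to \<open>Suc m\<close> involves only
  variables below \<open>i\<close>, so changing the coordinate \<open>Suc m\<close> affects none of
  their values.\<close>

lemma tower_variety_Suc_iff:
  assumes "triangular e g (Suc m)"
  shows "w(Suc m := z) \<in> tower_variety e g (Suc m) \<longleftrightarrow>
    w \<in> tower_variety e g m \<and> z ^ e (Suc m) = mpoly_eval (g (Suc m)) w"
proof -
  have "mpoly_eval (g i) (w(Suc m := z)) = mpoly_eval (g i) w" if "i \<in> {1..Suc m}" for i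
    using triangularD(2)[OF assms, of i] that by (intro mpoly_eval_cong) auto
  moreover have "{1..Suc m} = insert (Suc m) {1..m}" by auto
  ultimately show ?thesis unfolding tower_variety_def by auto
qed

lemma set_fibre:
  assumes "triangular e g m" "w \<in> set (fibre e g m v)"
  shows "w \<in> tower_variety e g m" "w 0 = v 0"
proof -
  have "w \<in> tower_variety e g m \<and> w 0 = v 0" using assms
  proof (induction m arbitrary: w)
    case 0
    then show ?case by (simp add: tower_variety_def)
  next
    case (Suc m)
    then obtain x z where x: "x \<in> set (fibre e g m v)" "w = x(Suc m := z)"
      "z ^ e (Suc m) = mpoly_eval (g (Suc m)) x"
      using triangularD(1)[OF Suc.prems(1), of "Suc m"] by (auto simp: set_root_list)
    have IH: "x \<in> tower_variety e g m \<and> x 0 = v 0"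
      by (rule Suc.IH[OF triangular_Suc[OF Suc.prems(1)] x(1)])
    then have "w \<in> tower_variety e g (Suc m)"
      unfolding x(2) tower_variety_Suc_iff[OF Suc.prems(1)] using x(3) by blast
    moreover have "w 0 = v 0" unfolding x(2) using IH by simp
    ultimately show ?case by blast
  qed
  then show "w \<in> tower_variety e g m" "w 0 = v 0" by simp_all
qed

text \<open>Ensures that a function vanishing at a point of the variety has a vanishing norm over
  that point's value of \<open>t\<close>.\<close>

lemma mem_fibre_self:
  assumes "triangular e g m" "v \<in> tower_variety e g m"
  shows "v \<in> set (fibre e g m v)"
  using assms
proof (induction m)
  case 0
  then show ?case by simp
next
  case (Suc m)
  have "v(Suc m := v (Suc m)) \<in> tower_variety e g (Suc m)" using Suc.prems(2) by simp
  then have v: "v \<in> tower_variety e g m" "v (Suc m) ^ e (Suc m) = mpoly_eval (g (Suc m)) v"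
    unfolding tower_variety_Suc_iff[OF Suc.prems(1)] by auto
  then have "v \<in> set (fibre e g m v)" using Suc.IH triangular_Suc[OF Suc.prems(1)] by blast
  moreover have "v (Suc m) \<in> set (root_list (e (Suc m)) (mpoly_eval (g (Suc m)) v))"
    using v(2) triangularD(1)[OF Suc.prems(1), of "Suc m"] by (simp add: set_root_list)
  ultimately show ?case by (auto intro!: bexI[of _ v] image_eqI[of _ _ "v (Suc m)"])
qed

text \<open>The index counts tower coordinates starting with \<open>t\<close>:
  \<open>coords 0\<close> sees only \<open>x\<close>, \<open>coords (Suc 0)\<close> sees
  \<open>x\<close> and \<open>t\<close>, and \<open>coords (Suc m)\<close> sees everything up to
  \<open>\<Delta>\<close> of index \<open>m\<close>.\<close>

definition coords :: "nat \<Rightarrow> ((complex ^ 'n) \<times> (nat \<Rightarrow> complex) \<Rightarrow> complex) set" where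
  "coords m = range (\<lambda>k s. vec_nth (fst s) k) \<union> (\<lambda>i s. snd s i) ` {..<m}"

lemma coords_Suc: "coords (Suc m) = insert (\<lambda>s. snd s m) (coords m)"
  by (simp add: coords_def lessThan_Suc)

lemma prod_list_concat_map:
  "prod_list (map f (concat xss)) = (\<Prod>xs\<leftarrow>xss. prod_list (map f xs))"
  by (induction xss) simp_all

text \<open>The norm is taken one level at a time: the product over the roots at the top level is a
  function of the lower coordinates by \<open>polyfuns_prod_root_list\<close>, and the rest is a
  norm for the shorter tower.\<close>

lemma polyfuns_prod_fibre:
  assumes "triangular e g m" "F \<in> polyfuns (coords (Suc m))"
  shows "(\<lambda>s. \<Prod>w\<leftarrow>fibre e g m (snd s). F (fst s, w)) \<in> polyfuns (coords (Suc 0))"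
  using assms
proof (induction m arbitrary: F)
  case 0
  then show ?case by simp
next
  case (Suc m)
  let ?u = "\<lambda>s. mpoly_eval (g (Suc m)) (snd s)"
  obtain P where P: "poly_family (coords (Suc m)) P" "\<And>s. F s = poly (P s) (snd s (Suc m))"
    using polyfuns_insert_expand[of F "\<lambda>s. snd s (Suc m)" "coords (Suc m)"] Suc.prems(2)
    unfolding coords_Suc[of "Suc m"] by blast
  \<comment> \<open>The coefficients lie over \<open>coords (Suc m)\<close>, which does not contain
    the coordinate \<open>Suc m\<close>.\<close>
  have "P (x, w(Suc m := z)) = P (x, w)" for x w z
    by (intro poly_eqI polyfuns_cong[OF poly_family_coeff[OF P(1)]]) (auto simp: coords_def)
  then have F: "F (x, w(Suc m := z)) = poly (P (x, w)) z" for x w z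
    by (simp add: P(2))
  define N where "N s = (\<Prod>z\<leftarrow>root_list (e (Suc m)) (?u s). poly (P s) z)" for s
  have u: "?u \<in> polyfuns (coords (Suc m))"
    using triangularD(2)[OF Suc.prems(1), of "Suc m"]
    by (intro polyfuns_mpoly_eval polyfuns.gen) (auto simp: coords_def)
  have N: "N \<in> polyfuns (coords (Suc m))" unfolding N_def
    by (rule polyfuns_prod_root_list[OF _ P(1) u]) (rule triangularD(1)[OF Suc.prems(1)], simp_all)
  have "(\<Prod>w\<leftarrow>fibre e g (Suc m) (snd s). F (fst s, w))
      = (\<Prod>w\<leftarrow>fibre e g m (snd s). N (fst s, w))" for s
    by (simp add: prod_list_concat_map o_def F N_def)
  then show ?case using Suc.IH[OF triangular_Suc[OF Suc.prems(1)] N] by simp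
qed

section \<open>Growth at infinity\<close>

lemma bigo_power_cancel:
  fixes f h :: "'a \<Rightarrow> 'b::real_normed_field"
  assumes "n > 0" "(\<lambda>x. f x ^ n) \<in> O[F](\<lambda>x. h x ^ n)" shows "f \<in> O[F](h)"
proof -
  from assms(2) obtain c where c: "c > 0" "eventually (\<lambda>x. norm (f x ^ n) \<le> c * norm (h x ^ n)) F"
    by (rule landau_o.bigE)
  \<comment> \<open>The constant is raised to at least \<open>1\<close> so that its
    \<open>n\<close>-th power still dominates \<open>c\<close>.\<close>
  define c' where "c' = max 1 c"
  have "c \<le> c' ^ n"
    using self_le_power[of c' n] assms(1) by (simp add: c'_def)
  have "eventually (\<lambda>x. norm (f x) \<le> c' * norm (h x)) F"
    using c(2)
  proof (rule eventually_mono)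
    fix x assume "norm (f x ^ n) \<le> c * norm (h x ^ n)"
    also have "\<dots> \<le> c' ^ n * norm (h x ^ n)" using \<open>c \<le> c' ^ n\<close> by (intro mult_right_mono) auto
    finally have "norm (f x) ^ n \<le> (c' * norm (h x)) ^ n"
      by (simp add: norm_power power_mult_distrib)
    then show "norm (f x) \<le> c' * norm (h x)"
      using assms(1) by (subst (asm) power_mono_iff) (auto simp: c'_def)
  qed
  then show ?thesis by (rule landau_o.bigI[rotated]) (simp add: c'_def)
qed

text \<open>Here "eventually" means at all points of the tower variety with large \<open>t\<close>,
  on every branch at once.\<close>

definition infinity_on :: "(nat \<Rightarrow> nat) \<Rightarrow> (nat \<Rightarrow> nat mpoly) \<Rightarrow> nat \<Rightarrow> (nat \<Rightarrow> complex) filter" where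
  "infinity_on e g m =
     inf (filtercomap (\<lambda>v. norm (v 0)) at_top) (principal (tower_variety e g m))"

text \<open>The comparison scale. Weights are fractional, and taking the modulus of \<open>t\<close>
  avoids choosing a branch of the power.\<close>

definition tpow :: "rat \<Rightarrow> (nat \<Rightarrow> complex) \<Rightarrow> complex" where
  "tpow a v = of_real (norm (v 0) powr of_rat a)"

lemma filterlim_infinity_on: "filterlim (\<lambda>v. norm (v 0)) at_top (infinity_on e g m)"
  unfolding infinity_on_def by (rule filterlim_mono[OF filterlim_filtercomap]) auto

lemma eventually_infinity_on_nonzero: "eventually (\<lambda>v. v 0 \<noteq> 0) (infinity_on e g m)"
  using filterlim_at_top_dense[THEN iffD1, OF filterlim_infinity_on, rule_format, of 0]
  by (auto elim: eventually_mono)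

lemma eventually_infinity_on_variety:
  "eventually (\<lambda>v. v \<in> tower_variety e g m) (infinity_on e g m)"
  unfolding infinity_on_def eventually_inf_principal by simp

text \<open>The case \<open>v 0 = 0\<close> is excluded because \<open>0 powr 0 = 0\<close>, against
  \<open>0 ^ 0 = 1\<close>.\<close>

lemma tpow_power: "v 0 \<noteq> 0 \<Longrightarrow> tpow a v ^ n = tpow (of_nat n * a) v"
  by (simp add: tpow_def powr_power of_rat_mult mult.commute flip: of_real_power)

lemma tpow_sum: "v 0 \<noteq> 0 \<Longrightarrow> tpow (\<Sum>k\<in>K. a k) v = (\<Prod>k\<in>K. tpow (a k) v)"
  by (simp add: tpow_def powr_sum of_rat_sum flip: of_real_prod)

lemma tpow_smallo:
  assumes "a < b" shows "tpow a \<in> o[infinity_on e g m](tpow b)"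
proof (rule smalloI_tendsto)
  have "((\<lambda>v. norm (v 0) powr of_rat (a - b)) \<longlongrightarrow> 0) (infinity_on e g m)"
    using assms by (intro tendsto_neg_powr filterlim_infinity_on) simp
  then have "((\<lambda>v. of_real (norm (v 0) powr of_rat (a - b)) :: complex) \<longlongrightarrow> of_real 0)
      (infinity_on e g m)"
    by (rule tendsto_of_real)
  then show "((\<lambda>v. tpow a v / tpow b v) \<longlongrightarrow> 0) (infinity_on e g m)"
    by (simp add: tpow_def of_rat_diff powr_diff)
  show "eventually (\<lambda>v. tpow b v \<noteq> 0) (infinity_on e g m)"
    using eventually_infinity_on_nonzero by (rule eventually_mono) (simp add: tpow_def)
qed

lemma tpow_bigo: "a \<le> b \<Longrightarrow> tpow a \<in> O[infinity_on e g m](tpow b)"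
  by (cases "a = b") (simp_all add: landau_o.small_imp_big tpow_smallo)

lemma mono_weight_tpow:
  "eventually (\<lambda>v. (\<Prod>k\<in>mvars \<mu>. tpow (w k) v ^ expo \<mu> k) = tpow (mono_weight w \<mu>) v)
     (infinity_on e g m)"
  using eventually_infinity_on_nonzero
  by (rule eventually_mono) (simp add: mono_weight_def tpow_sum tpow_power)

lemma monomial_bigo:
  assumes "\<And>k. k \<in> mvars \<mu> \<Longrightarrow> (\<lambda>v. v k) \<in> O[infinity_on e g m](tpow (w k))"
  shows "(\<lambda>v. \<Prod>k\<in>mvars \<mu>. v k ^ expo \<mu> k) \<in> O[infinity_on e g m](tpow (mono_weight w \<mu>))"
proof -
  have "(\<lambda>v. \<Prod>k\<in>mvars \<mu>. v k ^ expo \<mu> k)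
      \<in> O[infinity_on e g m](\<lambda>v. \<Prod>k\<in>mvars \<mu>. tpow (w k) v ^ expo \<mu> k)"
    by (intro landau_o.big_prod landau_o.big_power assms)
  then show ?thesis
    using landau_o.big.cong[OF mono_weight_tpow] by simp
qed

lemma monomial_bigtheta:
  assumes "\<And>k. k \<in> mvars \<mu> \<Longrightarrow> (\<lambda>v. v k) \<in> \<Theta>[infinity_on e g m](tpow (w k))"
  shows "(\<lambda>v. \<Prod>k\<in>mvars \<mu>. v k ^ expo \<mu> k) \<in> \<Theta>[infinity_on e g m](tpow (mono_weight w \<mu>))"
proof (rule bigthetaI)
  show "(\<lambda>v. \<Prod>k\<in>mvars \<mu>. v k ^ expo \<mu> k) \<in> O[infinity_on e g m](tpow (mono_weight w \<mu>))"
    using assms by (intro monomial_bigo) (auto simp: bigtheta_def)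
  have "(\<lambda>v. \<Prod>k\<in>mvars \<mu>. tpow (w k) v ^ expo \<mu> k)
      \<in> O[infinity_on e g m](\<lambda>v. \<Prod>k\<in>mvars \<mu>. v k ^ expo \<mu> k)"
    by (intro landau_o.big_prod landau_o.big_power bigthetaD1[OF iffD1[OF bigtheta_sym assms]])
  then have "tpow (mono_weight w \<mu>) \<in> O[infinity_on e g m](\<lambda>v. \<Prod>k\<in>mvars \<mu>. v k ^ expo \<mu> k)"
    using landau_o.big.in_cong[OF mono_weight_tpow] by blast
  then show "(\<lambda>v. \<Prod>k\<in>mvars \<mu>. v k ^ expo \<mu> k) \<in> \<Omega>[infinity_on e g m](tpow (mono_weight w \<mu>))"
    by (simp add: bigomega_iff_bigo)
qed

section \<open>Size of polynomials on the tower variety\<close>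

lemma wdeg_nonzero:
  assumes "f \<noteq> 0" obtains d where "wdeg e g f = Fin d"
    "\<And>\<mu>. \<mu> \<in> monomials f \<Longrightarrow> mono_weight (weight e g) \<mu> \<le> d"
    "\<exists>\<mu>\<in>monomials f. mono_weight (weight e g) \<mu> = d"
proof -
  let ?W = "(\<lambda>\<mu>. Fin (mono_weight (weight e g) \<mu>)) ` monomials f"
  have ne: "monomials f \<noteq> {}" using assms by simp
  obtain \<nu> where \<nu>: "\<nu> \<in> monomials f" using ne by blast
  have ub: "Fin (mono_weight (weight e g) \<mu>) \<le> wdeg e g f" if "\<mu> \<in> monomials f" for \<mu>
    unfolding wdeg_def wdeg_wrt_def using that by (intro Max_ge) auto
  have "wdeg e g f \<in> insert Minf ?W" unfolding wdeg_def wdeg_wrt_def by (rule Max_in) auto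
  moreover have "wdeg e g f \<noteq> Minf" using ub[OF \<nu>] by auto
  ultimately obtain \<mu> where "\<mu> \<in> monomials f" "wdeg e g f = Fin (mono_weight (weight e g) \<mu>)" by auto
  then show ?thesis using ub by (intro that[of "mono_weight (weight e g) \<mu>"]) auto
qed

text \<open>Cancellation among leading terms can only lower the growth, so the upper bound covers
  suspicious polynomials as well.\<close>

lemma mpoly_eval_bigo:
  assumes "\<And>k. k \<in> vars f \<Longrightarrow> (\<lambda>v. v k) \<in> O[infinity_on e g m](tpow (weight e g k))"
    and "\<And>\<mu>. \<mu> \<in> M \<Longrightarrow> mono_weight (weight e g) \<mu> \<le> d" "M \<subseteq> monomials f"
  shows "(\<lambda>v. \<Sum>\<mu>\<in>M. mcoeff f \<mu> * (\<Prod>k\<in>mvars \<mu>. v k ^ expo \<mu> k)) \<in> O[infinity_on e g m](tpow d)"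
proof (intro big_sum_in_bigo)
  fix \<mu> assume \<mu>: "\<mu> \<in> M"
  have "(\<lambda>v. \<Prod>k\<in>mvars \<mu>. v k ^ expo \<mu> k)
      \<in> O[infinity_on e g m](tpow (mono_weight (weight e g) \<mu>))"
    using \<mu> assms(3) by (intro monomial_bigo assms(1)) (auto simp: vars_def)
  also have "tpow (mono_weight (weight e g) \<mu>) \<in> O[infinity_on e g m](tpow d)"
    using assms(2)[OF \<mu>] by (rule tpow_bigo)
  finally show "(\<lambda>v. mcoeff f \<mu> * (\<Prod>k\<in>mvars \<mu>. v k ^ expo \<mu> k)) \<in> O[infinity_on e g m](tpow d)"
    by simp
qed

text \<open>There is exactly one leading monomial, and each of its variables has exact growth, for
  otherwise the second rule would make \<open>f\<close> suspicious. All other monomials have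
  strictly smaller weight and are negligible.\<close>

lemma mpoly_eval_bigtheta:
  assumes O: "\<And>k. k \<in> vars f \<Longrightarrow> (\<lambda>v. v k) \<in> O[infinity_on e g m](tpow (weight e g k))"
    and Th: "\<And>k. k \<in> vars f \<Longrightarrow> k = 0 \<or> \<not> suspicious e g (g k) \<Longrightarrow>
      (\<lambda>v. v k) \<in> \<Theta>[infinity_on e g m](tpow (weight e g k))"
    and f: "f \<noteq> 0" "\<not> suspicious e g f" and d: "wdeg e g f = Fin d"
  shows "mpoly_eval f \<in> \<Theta>[infinity_on e g m](tpow d)"
proof -
  let ?F = "infinity_on e g m" and ?w = "mono_weight (weight e g)"
  let ?mon = "\<lambda>\<mu> v. \<Prod>k\<in>mvars \<mu>. v k ^ expo \<mu> k"
  have le: "?w \<nu> \<le> d" if "\<nu> \<in> monomials f" for \<nu>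
    using wdeg_nonzero[OF f(1), of e g] d that by (metis extended.inject)
  have lead: "\<exists>\<mu>\<in>monomials f. ?w \<mu> = d"
    using wdeg_nonzero[OF f(1), of e g] d by (metis extended.inject)
  obtain \<mu> where \<mu>: "\<mu> \<in> monomials f" "?w \<mu> = d" using lead by blast
  have mem: "\<mu> \<in> leading_monomials e g f" using \<mu> d by (simp add: leading_monomials_def)
  have fin: "finite (leading_monomials e g f)"
    unfolding leading_monomials_def by simp
  have card: "card (leading_monomials e g f) < 2"
    using f(2) suspicious.several_leading[of e g f] by linarith
  have lm: "leading_monomials e g f = {\<mu>}"
  proof -
    have "card (leading_monomials e g f) = 1"
      using card mem fin card_gt_0_iff[of "leading_monomials e g f"] by force
    then show ?thesis using mem by (auto simp: card_1_singleton_iff)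
  qed
  have mon: "?mon \<mu> \<in> \<Theta>[?F](tpow d)" unfolding \<mu>(2)[symmetric]
  proof (rule monomial_bigtheta)
    fix k assume k: "k \<in> mvars \<mu>"
    have "k = 0 \<or> \<not> suspicious e g (g k)"
      using suspicious.leading_suspicious[OF lm _ k] f(2) by (cases "k = 0") auto
    then show "(\<lambda>v. v k) \<in> \<Theta>[?F](tpow (weight e g k))"
      using k \<mu>(1) by (intro Th) (auto simp: vars_def)
  qed
  have c: "mcoeff f \<mu> \<noteq> 0" using \<mu>(1) by (simp add: in_keys_iff)
  let ?M = "monomials f - {\<mu>}"
  have rest: "(\<lambda>v. \<Sum>\<nu>\<in>?M. mcoeff f \<nu> * ?mon \<nu> v) \<in> o[?F](tpow d)"
  proof (intro big_sum_in_smallo)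
    fix \<nu> assume \<nu>: "\<nu> \<in> ?M"
    have "?w \<nu> \<noteq> d" using \<nu> lm d by (auto simp: leading_monomials_def)
    then have "?w \<nu> < d" using le[of \<nu>] \<nu> by simp
    have "?mon \<nu> \<in> O[?F](tpow (?w \<nu>))"
      using \<nu> by (intro monomial_bigo O) (auto simp: vars_def)
    also have "tpow (?w \<nu>) \<in> o[?F](tpow d)" using \<open>?w \<nu> < d\<close> by (rule tpow_smallo)
    finally show "(\<lambda>v. mcoeff f \<nu> * ?mon \<nu> v) \<in> o[?F](tpow d)" by simp
  qed
  have "mpoly_eval f v = mcoeff f \<mu> * ?mon \<mu> v + (\<Sum>\<nu>\<in>?M. mcoeff f \<nu> * ?mon \<nu> v)" for v
    unfolding eval_via_def id_apply using \<mu>(1) by (intro sum.remove) auto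
  then have eq: "mpoly_eval f = (\<lambda>v. mcoeff f \<mu> * ?mon \<mu> v + (\<Sum>\<nu>\<in>?M. mcoeff f \<nu> * ?mon \<nu> v))"
    by (rule ext)
  have main: "(\<lambda>v. mcoeff f \<mu> * ?mon \<mu> v) \<in> \<Theta>[?F](tpow d)" using mon c by simp
  have "(\<lambda>v. \<Sum>\<nu>\<in>?M. mcoeff f \<nu> * ?mon \<nu> v) \<in> o[?F](\<lambda>v. mcoeff f \<mu> * ?mon \<mu> v)"
    using rest landau_o.small.cong_bigtheta[OF main] by simp
  then have "\<Theta>[?F](mpoly_eval f) = \<Theta>[?F](\<lambda>v. mcoeff f \<mu> * ?mon \<mu> v)"
    unfolding eq by (rule landau_theta.plus_absorb2)
  moreover have "mpoly_eval f \<in> \<Theta>[?F](mpoly_eval f)" by simp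
  ultimately have "mpoly_eval f \<in> \<Theta>[?F](\<lambda>v. mcoeff f \<mu> * ?mon \<mu> v)" by blast
  also note main
  finally show ?thesis .
qed

text \<open>Strong induction along the tower: on the variety \<open>v i ^ e i\<close> equals the
  value of \<open>g i\<close>, whose size is known from the lower variables, and
  \<open>e i\<close>-th roots of the bounds can be taken.\<close>

lemma tower_growth:
  assumes tri: "triangular e g m" and nz: "\<And>i. i \<in> {1..m} \<Longrightarrow> g i \<noteq> 0" and "i \<le> m"
  shows "(\<lambda>v. v i) \<in> O[infinity_on e g m](tpow (weight e g i))"
    and "i = 0 \<or> \<not> suspicious e g (g i) \<Longrightarrow> (\<lambda>v. v i) \<in> \<Theta>[infinity_on e g m](tpow (weight e g i))"
proof -
  let ?F = "infinity_on e g m"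
  have "(\<lambda>v. v i) \<in> O[?F](tpow (weight e g i)) \<and>
    (i = 0 \<or> \<not> suspicious e g (g i) \<longrightarrow> (\<lambda>v. v i) \<in> \<Theta>[?F](tpow (weight e g i)))"
    using \<open>i \<le> m\<close>
  proof (induction i rule: less_induct)
    case (less i)
    show ?case
    proof (cases "i = 0")
      case True
      have "weight e g 0 = 1" by (subst weight.simps) simp
      then have "tpow (weight e g 0) = (\<lambda>v. of_real (norm (v 0)))" by (auto simp: tpow_def)
      moreover have "(\<lambda>v. v 0) \<in> \<Theta>[?F](\<lambda>v. of_real (norm (v 0)))"
        by (intro bigthetaI landau_o.bigI[of 1] landau_omega.bigI[of 1]) auto
      ultimately show ?thesis using True by auto
    next
      case False
      then have i: "i \<in> {1..m}" using less.prems by simp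
      have e: "e i > 0" and vars: "vars (g i) \<subseteq> {..<i}" using triangularD[OF tri, of i] i by auto
      obtain d where d: "wdeg e g (g i) = Fin d"
        "\<And>\<mu>. \<mu> \<in> monomials (g i) \<Longrightarrow> mono_weight (weight e g) \<mu> \<le> d"
        using wdeg_nonzero[OF nz[OF i], of e g] by metis
      have w: "weight e g i = d / of_nat (e i)" using weight_eq[of i g e] False vars d(1) by simp
      have O: "(\<lambda>v. v k) \<in> O[?F](tpow (weight e g k))"
        and Th: "k = 0 \<or> \<not> suspicious e g (g k) \<Longrightarrow> (\<lambda>v. v k) \<in> \<Theta>[?F](tpow (weight e g k))"
        if "k \<in> vars (g i)" for k
        using less.IH[of k] that vars less.prems by auto
      have ev1: "eventually (\<lambda>v. mpoly_eval (g i) v = v i ^ e i) ?F"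
        using eventually_infinity_on_variety
        by (rule eventually_mono) (use i in \<open>auto simp: tower_variety_def\<close>)
      \<comment> \<open>This is where the recursive choice of the weight, \<open>d\<close> divided
        by \<open>e i\<close>, comes from.\<close>
      have ev2: "eventually (\<lambda>v. tpow d v = tpow (weight e g i) v ^ e i) ?F"
        using eventually_infinity_on_nonzero
        by (rule eventually_mono) (use e in \<open>simp add: tpow_power w\<close>)
      have "(\<lambda>v. mpoly_eval (g i) v) \<in> O[?F](tpow d)"
        unfolding eval_via_def id_apply by (rule mpoly_eval_bigo[OF O d(2)]) auto
      then have "(\<lambda>v. v i ^ e i) \<in> O[?F](\<lambda>v. tpow (weight e g i) v ^ e i)"
        using landau_o.big.in_cong[OF ev1] landau_o.big.cong[OF ev2] by simp
      then have O': "(\<lambda>v. v i) \<in> O[?F](tpow (weight e g i))" by (rule bigo_power_cancel[OF e])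
      moreover have "(\<lambda>v. v i) \<in> \<Theta>[?F](tpow (weight e g i))" if ns: "\<not> suspicious e g (g i)"
      proof (rule bigthetaI[OF O'])
        have "mpoly_eval (g i) \<in> \<Theta>[?F](tpow d)"
          by (rule mpoly_eval_bigtheta[OF O Th nz[OF i] ns d(1)])
        then have "tpow d \<in> O[?F](\<lambda>v. mpoly_eval (g i) v)" by (simp add: bigtheta_sym bigthetaD1)
        then have "(\<lambda>v. tpow (weight e g i) v ^ e i) \<in> O[?F](\<lambda>v. v i ^ e i)"
          using landau_o.big.in_cong[OF ev2] landau_o.big.cong[OF ev1] by simp
        then have "tpow (weight e g i) \<in> O[?F](\<lambda>v. v i)" by (rule bigo_power_cancel[OF e])
        then show "(\<lambda>v. v i) \<in> \<Omega>[?F](tpow (weight e g i))" by (simp add: bigomega_iff_bigo)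
      qed
      ultimately show ?thesis using False by blast
    qed
  qed
  then show "(\<lambda>v. v i) \<in> O[?F](tpow (weight e g i))"
    and "i = 0 \<or> \<not> suspicious e g (g i) \<Longrightarrow> (\<lambda>v. v i) \<in> \<Theta>[?F](tpow (weight e g i))" by blast+
qed

lemma quotient_tendsto_0:
  assumes tri: "triangular e g m" and nz: "\<And>i. i \<in> {1..m} \<Longrightarrow> g i \<noteq> 0"
    and vars: "vars p \<subseteq> {..m}" "vars q \<subseteq> {..m}"
    and p: "\<not> suspicious e g p" "wdeg e g q < wdeg e g p"
  shows "((\<lambda>v. mpoly_eval q v / mpoly_eval p v) \<longlongrightarrow> 0) (infinity_on e g m)"
    and "eventually (\<lambda>v. mpoly_eval p v \<noteq> 0) (infinity_on e g m)"
proof -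
  let ?F = "infinity_on e g m"
  \<comment> \<open>The degree of \<open>p\<close> exceeds another degree, so it is not minus
    infinity.\<close>
  have "wdeg e g 0 = Minf" by (simp add: wdeg_def wdeg_wrt_def)
  then have p0: "p \<noteq> 0" using p(2) by (auto simp: less_extended_def)
  obtain d where d: "wdeg e g p = Fin d" using wdeg_nonzero[OF p0] by metis
  have O: "(\<lambda>v. v k) \<in> O[?F](tpow (weight e g k))" if "k \<le> m" for k
    by (rule tower_growth(1)[OF tri nz that])
  have Th: "mpoly_eval p \<in> \<Theta>[?F](tpow d)"
    by (rule mpoly_eval_bigtheta[OF O tower_growth(2)[OF tri nz] p0 p(1) d]) (use vars in auto)
  have tp: "eventually (\<lambda>v. tpow d v \<noteq> 0) ?F"
    using eventually_infinity_on_nonzero by (rule eventually_mono) (simp add: tpow_def)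
  show "eventually (\<lambda>v. mpoly_eval p v \<noteq> 0) ?F"
    using eventually_nonzero_bigtheta[OF Th] tp by simp
  have "mpoly_eval q \<in> o[?F](tpow d)"
  proof (cases "q = 0")
    case True
    moreover have "mpoly_eval (0 :: nat mpoly) = (\<lambda>_. 0)" by (rule ext) simp
    ultimately show ?thesis by simp
  next
    case False
    then obtain d' where d': "wdeg e g q = Fin d'"
      "\<And>\<mu>. \<mu> \<in> monomials q \<Longrightarrow> mono_weight (weight e g) \<mu> \<le> d'"
      using wdeg_nonzero[OF False, of e g] by metis
    have "(\<lambda>v. mpoly_eval q v) \<in> O[?F](tpow d')"
      unfolding eval_via_def id_apply by (rule mpoly_eval_bigo[OF O d'(2)]) (use vars in auto)
    also have "tpow d' \<in> o[?F](tpow d)" using p(2) d d' by (intro tpow_smallo) simp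
    finally show ?thesis .
  qed
  then have "mpoly_eval q \<in> o[?F](mpoly_eval p)"
    using landau_o.small.cong_bigtheta[OF Th] by simp
  then show "((\<lambda>v. mpoly_eval q v / mpoly_eval p v) \<longlongrightarrow> 0) ?F" by (rule smalloD_tendsto)
qed

lemma poly_ratio_tendsto_1:
  fixes A B :: "complex poly"
  assumes lim: "((\<lambda>t. poly A t / poly B t) \<longlongrightarrow> 1) at_infinity"
  shows "degree A = degree B" "lead_coeff A = lead_coeff B" "lead_coeff B \<noteq> 0"
proof -
  \<comment> \<open>Both ratios tend to \<open>1\<close>; were the degrees different, one of them
    would tend to \<open>0\<close>.\<close>
  have "((\<lambda>t. poly B t / poly A t) \<longlongrightarrow> 1) at_infinity"
    using tendsto_inverse[OF lim] by (simp add: inverse_eq_divide)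
  then show deg: "degree A = degree B"
    using lim tendsto_unique[OF trivial_limit_at_infinity] poly_divide_tendsto_0_at_infinity
    by (metis linorder_neqE_nat zero_neq_one)
  \<comment> \<open>Division by zero yields \<open>0\<close>, so \<open>B = 0\<close> would make the
    limit \<open>0\<close>.\<close>
  have "B \<noteq> 0"
  proof
    assume "B = 0"
    then have "((\<lambda>t::complex. 0) \<longlongrightarrow> (1::complex)) at_infinity" using lim by simp
    then show False by (simp add: tendsto_const_iff trivial_limit_at_infinity)
  qed
  then show lB: "lead_coeff B \<noteq> 0" by simp
  let ?n = "degree B"
  have "((\<lambda>t. (poly A t / t ^ ?n) / (poly B t / t ^ ?n)) \<longlongrightarrow> lead_coeff A / lead_coeff B) at_infinity"
    using poly_divide_tendsto_aux[of A] poly_divide_tendsto_aux[of B] lB deg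
    by (intro tendsto_divide) simp_all
  moreover have "eventually (\<lambda>t. (poly A t / t ^ ?n) / (poly B t / t ^ ?n) = poly A t / poly B t) at_infinity"
    by (rule eventually_at_infinityI[of 1]) (auto simp: field_simps)
  ultimately have "((\<lambda>t. poly A t / poly B t) \<longlongrightarrow> lead_coeff A / lead_coeff B) at_infinity"
    by (rule Lim_transform_eventually)
  then have "lead_coeff A / lead_coeff B = 1"
    using tendsto_unique[OF trivial_limit_at_infinity _ lim] by blast
  then show "lead_coeff A = lead_coeff B" using lB by simp
qed

text \<open>The polynomials vanishing at \<open>v\<close> form a proper ideal; a common zero would
  put all generators, hence \<open>1\<close>, into it.\<close>

lemma base_ideal_no_common_zero:
  assumes tri: "triangular e g m"
    and ab: "a \<in> carrier (param_ring m)" "b \<in> carrier (param_ring m)"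
    and whole: "base_ideal m e g a b = carrier (param_ring m)"
    and v: "v \<in> tower_variety e g m" "mpoly_eval a v = 0"
  shows "mpoly_eval b v \<noteq> 0"
proof
  assume b: "mpoly_eval b v = 0"
  interpret R: cring "param_ring m" by (rule param_ring_cring)
  define I where "I = {f \<in> carrier (param_ring m). mpoly_eval f v = 0}"
  have ops: "f \<oplus>\<^bsub>param_ring m\<^esub> h = f + h" "f \<otimes>\<^bsub>param_ring m\<^esub> h = f * h"
    "\<zero>\<^bsub>param_ring m\<^esub> = 0" "\<one>\<^bsub>param_ring m\<^esub> = 1" for f h
    by (simp_all add: param_ring_def ring_of_type_algebra_def)
  have "ideal I (param_ring m)"
  proof (rule idealI)
    show "subgroup I (add_monoid (param_ring m))"
    proof
      fix f assume "f \<in> I"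
      then have f: "f \<in> carrier (param_ring m)" "mpoly_eval f v = 0" by (simp_all add: I_def)
      have "f + (\<ominus>\<^bsub>param_ring m\<^esub> f) = 0" using R.r_neg[OF f(1)] by (simp add: ops)
      then have "mpoly_eval (\<ominus>\<^bsub>param_ring m\<^esub> f) v = 0"
        using f(2) mpoly_eval_add[of f "\<ominus>\<^bsub>param_ring m\<^esub> f" v] by simp
      then show "inv\<^bsub>add_monoid (param_ring m)\<^esub> f \<in> I"
        unfolding a_inv_def[symmetric] using f(1) by (simp add: I_def)
    next
      fix f h assume "f \<in> I" "h \<in> I"
      then show "f \<otimes>\<^bsub>add_monoid (param_ring m)\<^esub> h \<in> I"
        using R.add.m_closed[of f h] by (simp add: I_def ops mpoly_eval_add)
    next
      show "\<one>\<^bsub>add_monoid (param_ring m)\<^esub> \<in> I"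
        using R.zero_closed by (simp add: I_def ops)
    qed (auto simp: I_def)
  next
    fix f h assume "f \<in> I" "h \<in> carrier (param_ring m)"
    then show "h \<otimes>\<^bsub>param_ring m\<^esub> f \<in> I" "f \<otimes>\<^bsub>param_ring m\<^esub> h \<in> I"
      using R.m_closed[of h f] R.m_closed[of f h] by (simp_all add: I_def ops mpoly_eval_mult)
  qed (rule R.ring_axioms)
  moreover have "rad_poly e g i \<in> I" if i: "i \<in> {1..m}" for i
  proof -
    have "vars (rad_poly e g i) \<subseteq> insert i (vars (g i))"
      using keys_diff[of "Poly_Mapping.single (Poly_Mapping.single i (e i)) (1::complex)" "g i"]
      by (auto simp: vars_def rad_poly_def split: if_splits)
    then have "vars (rad_poly e g i) \<subseteq> {..m}"
      using i triangularD(2)[OF tri, of i] by fastforce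
    moreover have "mpoly_eval (rad_poly e g i) v = 0"
      using v(1) i by (simp add: mpoly_eval_rad_poly tower_variety_def)
    ultimately show ?thesis by (simp add: I_def param_ring_def)
  qed
  then have "rad_poly e g ` {1..m} \<union> {a, b} \<subseteq> I" using ab v(2) b by (auto simp: I_def)
  ultimately have "base_ideal m e g a b \<subseteq> I"
    unfolding base_ideal_def genideal_def by blast
  then have "1 \<in> I" using whole R.one_closed by (auto simp: ops)
  then show False by (simp add: I_def)
qed

text \<open>The coefficients are powers of a number that is no root of the finitely many polynomials
  with coefficient families \<open>u w\<close>.\<close>

lemma generic_linear_form:
  fixes u :: "'w \<Rightarrow> 'n::finite \<Rightarrow> complex"
  assumes "finite W" "\<And>w. w \<in> W \<Longrightarrow> \<exists>k. u w k \<noteq> 0"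
  obtains c where "\<And>w. w \<in> W \<Longrightarrow> (\<Sum>k\<in>UNIV. c k * u w k) \<noteq> 0"
proof -
  \<comment> \<open>Distinct exponents keep the numbers \<open>u w k\<close> apart as coefficients
    of \<open>Q w\<close>.\<close>
  obtain f :: "'n \<Rightarrow> nat" where f: "inj f"
    using finite_imp_inj_to_nat_seg[of "UNIV :: 'n set"] by auto
  define Q where "Q w = (\<Sum>k\<in>UNIV. monom (u w k) (f k))" for w
  have "coeff (Q w) (f k) = u w k" for w k
    by (simp add: Q_def coeff_sum inj_eq[OF f])
  then have "Q w \<noteq> 0" if "w \<in> W" for w using assms(2)[OF that] by (metis coeff_0)
  then have "(\<Prod>w\<in>W. Q w) \<noteq> 0" using assms(1) by simp
  then obtain s where "poly (\<Prod>w\<in>W. Q w) s \<noteq> 0" by (metis poly_all_0_iff_0)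
  then have "(\<Sum>k\<in>UNIV. s ^ f k * u w k) \<noteq> 0" if "w \<in> W" for w
    using that assms(1) by (auto simp: poly_prod Q_def poly_sum poly_monom mult.commute)
  then show ?thesis by (rule that)
qed

lemma zariski_closedI:
  fixes A :: "(complex ^ 'n::finite) set"
  assumes "\<And>y. y \<notin> A \<Longrightarrow>
    \<exists>f. (\<forall>x\<in>A. mpoly_eval f (vec_nth x) = 0) \<and> mpoly_eval f (vec_nth y) \<noteq> 0"
  shows "zariski_closed A"
  unfolding zariski_closed_def
  by (rule exI[of _ "{f. \<forall>x\<in>A. mpoly_eval f (vec_nth x) = 0}"]) (use assms in auto)

section \<open>Closedness of the image\<close>

text \<open>The quotient of the norm by its value at \<open>x = 0\<close> tends to \<open>1\<close> as \<open>t\<close> tends to infinity.\<close>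

lemma norm_lead_coeff:
  fixes x :: complex
  assumes tri: "triangular e g m" and nz: "\<And>i. i \<in> {1..m} \<Longrightarrow> g i \<noteq> 0"
    and vars: "vars p \<subseteq> {..m}" "vars q \<subseteq> {..m}"
    and p: "\<not> suspicious e g p" "wdeg e g q < wdeg e g p"
    and A: "\<And>t. poly A t = (\<Prod>w\<leftarrow>fibre e g m (\<lambda>_. t). mpoly_eval p w - x * mpoly_eval q w)"
    and B: "\<And>t. poly B t = (\<Prod>w\<leftarrow>fibre e g m (\<lambda>_. t). mpoly_eval p w)"
  shows "degree A = degree B" "lead_coeff A = lead_coeff B" "lead_coeff B \<noteq> 0"
proof -
  define D where "D = (\<Prod>i\<in>{1..m}. e i)"
  \<comment> \<open>Branch \<open>l\<close> of the fibre. Roots are chosen arbitrarily, so it need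
    not be continuous in \<open>t\<close>; the limit only uses that it stays on the variety above
    \<open>t\<close>.\<close>
  define u where "u l t = fibre e g m (\<lambda>_. t) ! l" for l t
  have u: "u l t \<in> tower_variety e g m" "u l t 0 = t" if "l < D" for l t
    using set_fibre[OF tri, of "u l t" "\<lambda>_. t"] that
    by (simp_all add: u_def length_fibre D_def)
  have lim: "filterlim (u l) (infinity_on e g m) at_infinity" if "l < D" for l
    unfolding infinity_on_def
  proof (intro filterlim_inf[THEN iffD2] conjI)
    show "filterlim (u l) (filtercomap (\<lambda>v. norm (v 0)) at_top) at_infinity"
      unfolding filterlim_filtercomap_iff o_def u(2)[OF that] by (rule filterlim_norm_at_top)
    show "filterlim (u l) (principal (tower_variety e g m)) at_infinity"
      unfolding filterlim_principal using u(1)[OF that] by simp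
  qed
  note q0 = quotient_tendsto_0[OF tri nz vars p]
  have prod: "(\<Prod>w\<leftarrow>fibre e g m (\<lambda>_. t). f w) = (\<Prod>l<D. f (u l t))"
    for f :: "(nat \<Rightarrow> complex) \<Rightarrow> complex" and t
    by (simp add: prod.list_conv_set_nth length_fibre D_def u_def atLeast0LessThan)
  \<comment> \<open>Each factor of the quotient of norms is
    \<open>(p - x q) / p = 1 - x (q / p)\<close>.\<close>
  have "((\<lambda>t. 1 - x * (mpoly_eval q (u l t) / mpoly_eval p (u l t))) \<longlongrightarrow> 1 - x * 0) at_infinity"
    if "l < D" for l
    by (intro tendsto_intros filterlim_compose[OF q0(1) lim[OF that]])
  then have "((\<lambda>t. \<Prod>l<D. 1 - x * (mpoly_eval q (u l t) / mpoly_eval p (u l t))) \<longlongrightarrow> (\<Prod>l<D. 1))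
      at_infinity"
    by (intro tendsto_prod) simp
  moreover have "eventually (\<lambda>t. \<forall>l\<in>{..<D}. mpoly_eval p (u l t) \<noteq> 0) at_infinity"
    using eventually_compose_filterlim[OF q0(2) lim] by (intro eventually_ball_finite) auto
  then have "eventually (\<lambda>t. (\<Prod>l<D. 1 - x * (mpoly_eval q (u l t) / mpoly_eval p (u l t)))
      = poly A t / poly B t) at_infinity"
  proof (rule eventually_mono)
    fix t assume "\<forall>l\<in>{..<D}. mpoly_eval p (u l t) \<noteq> 0"
    then show "(\<Prod>l<D. 1 - x * (mpoly_eval q (u l t) / mpoly_eval p (u l t))) = poly A t / poly B t"
      unfolding A B prod prod_dividef[symmetric]
      by (intro prod.cong) (auto simp: field_simps)
  qed
  ultimately have "((\<lambda>t. poly A t / poly B t) \<longlongrightarrow> 1) at_infinity"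
    using tendsto_cong by fastforce
  then show "degree A = degree B" "lead_coeff A = lead_coeff B" "lead_coeff B \<noteq> 0"
    by (fact poly_ratio_tendsto_1)+
qed

theorem corollary4p13:
  fixes j :: "complex poly fract \<Rightarrow> 'f::field"
    and m :: nat
    and \<delta> :: "nat \<Rightarrow> 'f"
    and e :: "nat \<Rightarrow> nat"
    and g :: "nat \<Rightarrow> nat mpoly"
    and p q :: "'n::finite \<Rightarrow> nat mpoly"
  assumes "radical_curve_parametrization j m \<delta> e g p q"
    and "\<And>k. normal_form e g m (p k) = p k"
    and "\<And>k. normal_form e g m (q k) = q k"
    and "\<exists>k. \<not> suspicious e g (p k) \<and> wdeg e g (p k) > wdeg e g (q k)"
    and "\<And>k. base_ideal m e g (p k) (q k) = carrier (param_ring m)"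
  shows "surjective_param m e g p q"
proof -
  have tri: "triangular e g m" and nz: "\<And>i. i \<in> {1..m} \<Longrightarrow> g i \<noteq> 0"
    and car: "\<And>k. p k \<in> carrier (param_ring m)" "\<And>k. q k \<in> carrier (param_ring m)"
    using assms(1)
    by (auto simp: radical_curve_parametrization_def radical_tower_def defining_polys_def triangular_def)
  have vars: "vars (p k) \<subseteq> {..m}" "vars (q k) \<subseteq> {..m}" for k
    using car[of k] by (simp_all add: param_ring_def)
  obtain k0 where k0: "\<not> suspicious e g (p k0)" "wdeg e g (q k0) < wdeg e g (p k0)"
    using assms(4) by blast
  let ?X = "param_image m e g p q"
  define F :: "'n \<Rightarrow> (complex ^ 'n) \<times> (nat \<Rightarrow> complex) \<Rightarrow> complex"
    where "F k s = mpoly_eval (p k) (snd s) - vec_nth (fst s) k * mpoly_eval (q k) (snd s)" for k s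
  have FB: "F k \<in> polyfuns (coords (Suc m))" for k
  proof -
    have ev: "(\<lambda>s. mpoly_eval f (snd s)) \<in> polyfuns (coords (Suc m))" if "vars f \<subseteq> {..m}" for f
      using that by (intro polyfuns_mpoly_eval polyfuns.gen) (auto simp: coords_def)
    then show ?thesis unfolding F_def
      by (intro polyfuns_minus polyfuns.mult ev vars polyfuns.gen[of "\<lambda>s. vec_nth (fst s) k"])
        (auto simp: coords_def)
  qed
  \<comment> \<open>Norms become polynomials in \<open>t\<close> over functions of \<open>x\<close>;
    the product formula is so far stated only at the value \<open>snd s 0\<close> of
    \<open>t\<close>.\<close>
  have norm_family: "\<exists>P. poly_family (coords 0) P \<and>
      (\<forall>s. poly (P s) (snd s 0) = (\<Prod>w\<leftarrow>fibre e g m (snd s). h (fst s, w)))"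
    if "h \<in> polyfuns (coords (Suc m))" for h :: "(complex ^ 'n) \<times> (nat \<Rightarrow> complex) \<Rightarrow> complex"
    using polyfuns_insert_expand[OF polyfuns_prod_fibre[OF tri that, unfolded coords_Suc]] by metis
  \<comment> \<open>Over \<open>coords 0\<close> the tower component of \<open>s\<close> is a dummy.
    Replacing it by a constant \<open>t\<close> extends the product formula to all
    \<open>t\<close>.\<close>
  have fam_cong: "P (x, v) = P (x, v')" if "poly_family (coords 0) P"
    for P :: "(complex ^ 'n) \<times> (nat \<Rightarrow> complex) \<Rightarrow> complex poly" and x v v'
    by (intro poly_eqI polyfuns_cong[OF poly_family_coeff[OF that]]) (auto simp: coords_def)
  obtain R where R: "poly_family (coords 0) R"
    "\<And>s. poly (R s) (snd s 0) = (\<Prod>w\<leftarrow>fibre e g m (snd s). F k0 (fst s, w))"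
    using norm_family[OF FB] by blast
  have R': "poly (R (x, v)) t = (\<Prod>w\<leftarrow>fibre e g m (\<lambda>_. t). F k0 (x, w))" for x v t
    using R(2)[of "(x, \<lambda>_. t)"] fam_cong[OF R(1), of x v "\<lambda>_. t"] by simp
  \<comment> \<open>The norm at \<open>x = 0\<close> is the norm of \<open>p k0\<close>; its leading
    coefficient is shared by all \<open>R s\<close>, so dividing by it gives the monic
    \<open>M\<close>.\<close>
  define B where "B = R (0, \<lambda>_. 0)"
  have R_lead: "degree (R s) = degree B \<and> lead_coeff (R s) = lead_coeff B \<and> lead_coeff B \<noteq> 0" for s
  proof -
    obtain x v where s: "s = (x, v)" by (cases s)
    have A: "poly (R s) t = (\<Prod>w\<leftarrow>fibre e g m (\<lambda>_. t).
        mpoly_eval (p k0) w - vec_nth x k0 * mpoly_eval (q k0) w)" for t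
      by (simp add: s R' F_def)
    have B: "poly B t = (\<Prod>w\<leftarrow>fibre e g m (\<lambda>_. t). mpoly_eval (p k0) w)" for t
      by (simp add: B_def R' F_def)
    show ?thesis using norm_lead_coeff[OF tri nz vars k0 A B] by blast
  qed
  define M where "M s = smult (inverse (lead_coeff B)) (R s)" for s
  have "poly_family (coords 0) M" unfolding M_def
    by (intro poly_family_smult polyfuns.const R(1))
  moreover have "degree (M s) = degree B" "lead_coeff (M s) = 1" for s
    using R_lead[of s] by (auto simp: M_def)
  ultimately have M: "poly_family (coords 0) M" "\<And>s. degree (M s) = degree B"
    "\<And>s. lead_coeff (M s) = 1" by blast+
  have M0: "poly (M s) t = 0 \<longleftrightarrow> poly (R s) t = 0" for s t
    using R_lead by (simp add: M_def)
  have "zariski_closed ?X"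
  proof (rule zariski_closedI)
    fix y assume y: "y \<notin> ?X"
    \<comment> \<open>If all \<open>F k\<close> vanished at \<open>w\<close>, a zero of some
      \<open>q k\<close> would also be a zero of \<open>p k\<close>, against the ideal hypothesis.
      So every \<open>q k\<close> is nonzero at \<open>w\<close>, and \<open>w\<close> is mapped to
      \<open>y\<close>.\<close>
    have sep: "\<exists>k. F k (y, w) \<noteq> 0" if w: "w \<in> tower_variety e g m" for w
    proof (rule ccontr)
      assume "\<not> ?thesis"
      then have eq: "mpoly_eval (p k) w = vec_nth y k * mpoly_eval (q k) w" for k
        by (simp add: F_def)
      then have q: "mpoly_eval (q k) w \<noteq> 0" for k
        using base_ideal_no_common_zero[OF tri car(1)[of k] car(2)[of k] assms(5) w] by auto
      then have "y = (\<chi> k. mpoly_eval (p k) w / mpoly_eval (q k) w)"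
        by (simp add: Finite_Cartesian_Product.vec_eq_iff eq)
      then have "y \<in> ?X" using q w
        by (auto simp: param_image_def mpoly_eval_rad_poly tower_variety_def)
      then show False using y by blast
    qed
    define W where "W = (\<Union>t\<in>{t. poly (R (y, \<lambda>_. 0)) t = 0}. set (fibre e g m (\<lambda>_. t)))"
    have "R (y, \<lambda>_. 0) \<noteq> 0" using M(3)[of "(y, \<lambda>_. 0)"] by (auto simp: M_def)
    then have "finite W" unfolding W_def by (intro finite_UN_I poly_roots_finite) auto
    moreover have "W \<subseteq> tower_variety e g m" unfolding W_def using set_fibre(1)[OF tri] by blast
    ultimately obtain c where c: "\<And>w. w \<in> W \<Longrightarrow> (\<Sum>k\<in>UNIV. c k * F k (y, w)) \<noteq> 0"
      using generic_linear_form[of W "\<lambda>w k. F k (y, w)"] sep by blast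
    define h where "h s = (\<Sum>k\<in>UNIV. c k * F k s)" for s
    have "h \<in> polyfuns (coords (Suc m))" unfolding h_def
      by (intro polyfuns_sum polyfuns.mult polyfuns.const FB)
    then obtain H where H: "poly_family (coords 0) H"
      "\<And>s. poly (H s) (snd s 0) = (\<Prod>w\<leftarrow>fibre e g m (snd s). h (fst s, w))"
      using norm_family by blast
    have H': "poly (H (x, v)) t = (\<Prod>w\<leftarrow>fibre e g m (\<lambda>_. t). h (x, w))" for x v t
      using H(2)[of "(x, \<lambda>_. t)"] fam_cong[OF H(1), of x v "\<lambda>_. t"] by simp
    obtain f where f: "f \<in> polyfuns (coords 0)"
      "\<And>s. f s = 0 \<longleftrightarrow> (\<exists>t. poly (M s) t = 0 \<and> poly (H s) t = 0)"
      using monic_elimination[OF M H(1)] by blast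
    have "f \<in> polyfuns (range (\<lambda>k s. vec_nth (fst s) k))" using f(1) by (simp add: coords_def)
    then obtain \<phi> where \<phi>: "\<And>s. f s = mpoly_eval \<phi> (vec_nth (fst s))"
      using polyfuns_imp_mpoly[of f "\<lambda>s. vec_nth (fst s)"] by blast
    have "mpoly_eval \<phi> (vec_nth x) = 0" if x: "x \<in> ?X" for x
    proof -
      obtain v where v: "v \<in> tower_variety e g m" "\<And>k. mpoly_eval (q k) v \<noteq> 0"
        "x = (\<chi> k. mpoly_eval (p k) v / mpoly_eval (q k) v)"
        using x by (auto simp: param_image_def mpoly_eval_rad_poly tower_variety_def)
      have F0: "F k (x, v) = 0" for k using v(2)[of k] by (simp add: F_def v(3))
      then have h0: "h (x, v) = 0" by (simp add: h_def)
      \<comment> \<open>Both norms over \<open>x\<close> contain a zero factor at \<open>v\<close>,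
        so \<open>t = v 0\<close> is a common root.\<close>
      have "v \<in> set (fibre e g m v)" by (rule mem_fibre_self[OF tri v(1)])
      then have "poly (R (x, v)) (v 0) = 0" "poly (H (x, v)) (v 0) = 0"
        using R(2)[of "(x, v)"] H(2)[of "(x, v)"] F0[of k0] h0
        by force+
      then have "f (x, v) = 0" using f(2) M0 by blast
      then show ?thesis using \<phi>[of "(x, v)"] by simp
    qed
    moreover have "mpoly_eval \<phi> (vec_nth y) \<noteq> 0"
    proof
      assume "mpoly_eval \<phi> (vec_nth y) = 0"
      then have "f (y, \<lambda>_. 0) = 0" using \<phi> by simp
      then obtain t where t: "poly (R (y, \<lambda>_. 0)) t = 0" "poly (H (y, \<lambda>_. 0)) t = 0"
        using f(2) M0 by blast
      \<comment> \<open>A vanishing norm has a vanishing factor, here at a point of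
        \<open>W\<close>, where \<open>c\<close> was chosen to make \<open>h\<close>
        nonzero.\<close>
      then obtain w where "w \<in> set (fibre e g m (\<lambda>_. t))" "h (y, w) = 0"
        unfolding H' by auto
      then show False using c[of w] t(1) by (auto simp: W_def h_def)
    qed
    ultimately show "\<exists>f. (\<forall>x\<in>?X. mpoly_eval f (vec_nth x) = 0) \<and> mpoly_eval f (vec_nth y) \<noteq> 0"
      by blast
  qed
  then show ?thesis by (simp add: surjective_param_def)
qed

end
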